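(* Let $G$ be a finite simple graph, let $k\ge 2$, and let $G\sqcup v$ be the graph consisting of $G$ together with one additional isolated vertex $v$. Then: (a) there is a homotopy equivalence $\Delta_k^t(G\sqcup v)\simeq \Delta_{k-1}^t(G)/\Delta_k^t(G)$; if in addition $\Delta_k^t(G)$ is contractible in $\Delta_{k-1}^t(G)$, then $\Delta_k^t(G\sqcup v)\simeq \Delta_{k-1}^t(G)\vee \mathrm{susp}\,\Delta_k^t(G)$; (b) there is a long exact sequence in reduced homology $$\cdots \to \tilde{H}_i(\Delta^t_k(G)) \to \tilde{H}_i(\Delta^t_{k-1}(G)) \to \tilde{H}_i(\Delta^t_k(G \sqcup v)) \to \tilde{H}_{i-1}(\Delta^t_k(G)) \to \cdots.$$
   Context: For $j\ge 1$, the total $j$-cut complex $\Delta_j^t(G)$ is the simplicial complex on $V(G)$ whose facets are the complements $V(G)\setminus S$ of independent sets $S$ of size $j$ in $G$ (void if there are none). Note $\Delta_k^t(G)\subseteq\Delta_{k-1}^t(G)$. A subcomplex $A$ is contractible in $X$ if the inclusion $A\hookrightarrow X$ is null-homotopic. $\mathrm{susp}$ denotes suspension, $\vee$ the wedge, $X/A$ the quotient space, all for geometric realizations. *)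

theory Defs
  imports "HOL-Homology.Homology"
begin

section \<open>Graphs and total cut complexes\<close>

type_synonym 'a graph = "'a set \<times> 'a set set"

definition finite_simple_graph :: "'a graph \<Rightarrow> bool" where
  "finite_simple_graph G \<longleftrightarrow> finite (fst G) \<and> (\<forall>e\<in>snd G. e \<subseteq> fst G \<and> card e = 2)"

definition add_isolated_vertex :: "'a graph \<Rightarrow> 'a \<Rightarrow> 'a graph" where
  "add_isolated_vertex G v = (insert v (fst G), snd G)"

definition independent_set :: "'a graph \<Rightarrow> 'a set \<Rightarrow> bool" where
  "independent_set G S \<longleftrightarrow> S \<subseteq> fst G \<and> (\<forall>x\<in>S. \<forall>y\<in>S. {x, y} \<notin> snd G)"

text \<open>
  A complex is given by its set of faces, the empty face included. The void complex \<^term>\<open>{}\<close>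
  (no faces at all) and the complex \<^term>\<open>{{}}\<close> (whose only face is empty) are different,
  although both have an empty geometric realization.
\<close>

definition total_cut_complex :: "nat \<Rightarrow> 'a graph \<Rightarrow> 'a set set" where
  "total_cut_complex j G = {F. \<exists>S. independent_set G S \<and> card S = j \<and> F \<subseteq> fst G - S}"

section \<open>Geometric realization\<close>

text \<open>
  Points are barycentric coordinate functions. The product topology is the right one because
  only complexes with finitely many vertices are considered.
\<close>

definition realization :: "'a set set \<Rightarrow> ('a \<Rightarrow> real) topology" where
  "realization K = subtopology (powertop_real UNIV)
     {b. (\<forall>x. 0 \<le> b x) \<and> finite {x. b x \<noteq> 0} \<and> {x. b x \<noteq> 0} \<in> K \<and> (\<Sum>x | b x \<noteq> 0. b x) = 1}"

definition contractible_in :: "'a topology \<Rightarrow> 'a topology \<Rightarrow> bool" where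
  "contractible_in A X \<longleftrightarrow>
     (\<exists>c. homotopic_with (\<lambda>_. True) A X id (\<lambda>_. c))"

section \<open>Quotient, suspension and wedge\<close>

definition quotient_topology :: "'a topology \<Rightarrow> ('a \<Rightarrow> 'b) \<Rightarrow> 'b topology" where
  "quotient_topology X q =
     topology (\<lambda>U. U \<subseteq> q ` topspace X \<and> openin X {x \<in> topspace X. q x \<in> U})"

lemma openin_quotient_topology:
  "openin (quotient_topology X q) U \<longleftrightarrow>
     U \<subseteq> q ` topspace X \<and> openin X {x \<in> topspace X. q x \<in> U}"
proof -
  have "istopology (\<lambda>U. U \<subseteq> q ` topspace X \<and> openin X {x \<in> topspace X. q x \<in> U})"
    unfolding istopology_def
  proof (intro conjI allI impI)
    fix S T
    assume S: "S \<subseteq> q ` topspace X \<and> openin X {x \<in> topspace X. q x \<in> S}"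
      and T: "T \<subseteq> q ` topspace X \<and> openin X {x \<in> topspace X. q x \<in> T}"
    show "S \<inter> T \<subseteq> q ` topspace X"
      using S by blast
    have "{x \<in> topspace X. q x \<in> S \<inter> T} = {x \<in> topspace X. q x \<in> S} \<inter> {x \<in> topspace X. q x \<in> T}"
      by blast
    then show "openin X {x \<in> topspace X. q x \<in> S \<inter> T}"
      using S T by auto
  next
    fix \<K>
    assume K: "\<forall>K\<in>\<K>. K \<subseteq> q ` topspace X \<and> openin X {x \<in> topspace X. q x \<in> K}"
    show "\<Union>\<K> \<subseteq> q ` topspace X"
      using K by blast
    have "{x \<in> topspace X. q x \<in> \<Union>\<K>} = (\<Union>K\<in>\<K>. {x \<in> topspace X. q x \<in> K})"
      by blast
    then show "openin X {x \<in> topspace X. q x \<in> \<Union>\<K>}"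
      using K by auto
  qed
  then show ?thesis
    by (simp add: quotient_topology_def topology_inverse')
qed

lemma topspace_quotient_topology [simp]: "topspace (quotient_topology X q) = q ` topspace X"
proof (rule antisym)
  show "topspace (quotient_topology X q) \<subseteq> q ` topspace X"
    using openin_topspace[of "quotient_topology X q"] unfolding openin_quotient_topology by simp
  have "{x \<in> topspace X. q x \<in> q ` topspace X} = topspace X"
    by blast
  then have "openin (quotient_topology X q) (q ` topspace X)"
    by (simp add: openin_quotient_topology)
  then show "q ` topspace X \<subseteq> topspace (quotient_topology X q)"
    by (rule openin_subset)
qed

lemma quotient_map_quotient_topology: "quotient_map X (quotient_topology X q) q"
  by (auto simp: quotient_map_def openin_quotient_topology)

definition disjoint_union :: "'a topology \<Rightarrow> 'b topology \<Rightarrow> ('a + 'b) topology" where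
  "disjoint_union X Y = topology (\<lambda>U. openin X (Inl -` U) \<and> openin Y (Inr -` U))"

lemma openin_disjoint_union:
  "openin (disjoint_union X Y) U \<longleftrightarrow> openin X (Inl -` U) \<and> openin Y (Inr -` U)"
proof -
  have "istopology (\<lambda>U. openin X (Inl -` U) \<and> openin Y (Inr -` U))"
    unfolding istopology_def vimage_Int vimage_Union by (auto intro!: openin_Int openin_Union)
  then show ?thesis
    by (simp add: disjoint_union_def topology_inverse')
qed

lemma topspace_disjoint_union [simp]:
  "topspace (disjoint_union X Y) = Inl ` topspace X \<union> Inr ` topspace Y"
proof (rule antisym)
  have "openin X (Inl -` topspace (disjoint_union X Y))"
    "openin Y (Inr -` topspace (disjoint_union X Y))"
    using openin_topspace[of "disjoint_union X Y"] unfolding openin_disjoint_union by simp_all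
  then have "Inl -` topspace (disjoint_union X Y) \<subseteq> topspace X"
    "Inr -` topspace (disjoint_union X Y) \<subseteq> topspace Y"
    by (simp_all add: openin_subset)
  then show "topspace (disjoint_union X Y) \<subseteq> Inl ` topspace X \<union> Inr ` topspace Y"
    by (intro subsetI, rename_tac z, case_tac z) blast+
  have "Inl -` (Inl ` topspace X \<union> Inr ` topspace Y) = topspace X"
    "Inr -` (Inl ` topspace X \<union> Inr ` topspace Y) = topspace Y"
    by auto
  then have "openin (disjoint_union X Y) (Inl ` topspace X \<union> Inr ` topspace Y)"
    by (simp add: openin_disjoint_union)
  then show "Inl ` topspace X \<union> Inr ` topspace Y \<subseteq> topspace (disjoint_union X Y)"
    by (rule openin_subset)
qed

text \<open>
  Both constructions below glue in the extra point(s) from outside, so that for an empty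
  \<open>A\<close> the quotient is \<open>X\<close> with a disjoint point added, and the suspension of the
  empty space is a two-point space.
\<close>

definition collapse :: "'a topology \<Rightarrow> 'a set \<Rightarrow> 'a option topology" where
  "collapse X A = quotient_topology (disjoint_union X (discrete_topology {()}))
     (case_sum (\<lambda>x. if x \<in> A then None else Some x) (\<lambda>_. None))"

definition suspension :: "'a topology \<Rightarrow> ('a \<times> real + bool) topology" where
  "suspension X =
     quotient_topology
       (disjoint_union (prod_topology X (top_of_set {0..1})) (discrete_topology UNIV))
       (case_sum
         (\<lambda>(x, t). if t = 0 then Inr False else if t = 1 then Inr True else Inl (x, t)) Inr)"

definition wedge :: "'a topology \<Rightarrow> 'a \<Rightarrow> 'b topology \<Rightarrow> 'b \<Rightarrow> ('a + 'b) topology" where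
  "wedge X x Y y = quotient_topology (disjoint_union X Y)
     (case_sum Inl (\<lambda>b. if b = y then Inl x else Inr b))"

text \<open>
  For the void complex the convention is \<open>K / void = K\<close>; for all other subcomplexes
  \<open>L\<close>, \<^term>\<open>{{}}\<close> included, the realization of \<open>L\<close> is collapsed to a point.
\<close>

definition complex_quotient :: "'a set set \<Rightarrow> 'a set set \<Rightarrow> ('a \<Rightarrow> real) option topology" where
  "complex_quotient K L =
     (if L = {} then quotient_topology (realization K) Some
      else collapse (realization K) (topspace (realization L)))"

section \<open>Reduced homology\<close>

text \<open>
  Singular reduced homology of the realization, except that the complex \<^term>\<open>{{}}\<close> has
  reduced homology \<open>\<int>\<close> in degree \<open>-1\<close>; there the group \<open>\<int>\<close> is represented by the
  zeroth homology group of a one-point space, in order to have the same type.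
\<close>

definition complex_reduced_homology ::
    "int \<Rightarrow> 'a set set \<Rightarrow> ('a \<Rightarrow> real) chain set monoid" where
  "complex_reduced_homology p K =
     (if p = -1 \<and> K = {{}} then homology_group 0 (discrete_topology {\<lambda>_. 0})
      else reduced_homology_group p (realization K))"

lemma complex_reduced_homology_empty_face:
  "complex_reduced_homology (-1) {{}} \<cong> integer_group"
  by (simp add: complex_reduced_homology_def homology_coefficients)

end

theory Submission
  imports Defs "HOL-Analysis.Analysis"
begin

text \<open>
  Write \<open>K\<close>, \<open>L\<close> and \<open>M\<close> for the complexes \<open>\<Delta>\<^sub>k\<^sub>-\<^sub>1(G)\<close>, \<open>\<Delta>\<^sub>k(G)\<close> and \<open>\<Delta>\<^sub>k(G \<squnion> v)\<close>. An independent
  set of \<open>G \<squnion> v\<close> of size \<open>k\<close> either contains \<open>v\<close> or not, so \<open>M\<close> is \<open>K\<close> with a cone over \<open>L\<close>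
  attached. An explicit homotopy of \<open>M\<close> that contracts this cone within itself gives \<open>M \<simeq> K / L\<close>.
  If the inclusion of \<open>L\<close> into \<open>K\<close> is homotopic to a constant map, then the two mapping cones are
  homotopy equivalent, and the mapping cone of a constant map is \<open>K \<or> susp L\<close>. The base points are
  arbitrary because points of \<open>K\<close> have contractible neighbourhoods and because \<open>K\<close> is connected
  as soon as \<open>L\<close> has a vertex \<open>w\<close>: every vertex of \<open>K\<close> is then joined to \<open>w\<close>. For the exact
  sequence, excision of the apex identifies the reduced homology of \<open>M\<close> with the homology of the
  pair \<open>(K, L)\<close>; if \<open>L\<close> has only the empty face, the augmentation of \<open>K\<close> replaces the boundary map.
\<close>

section \<open>Homotopies on quotient spaces\<close>

text \<open>Two demands shape the homotopy behind (a): it must keep the cone inside itself at every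
  time, so that it passes to the quotient, and it must end constant on the cone. The straight-line
  contraction of the cone makes no sense on the rest of \<open>M\<close>, because a point of
  \<open>K\<close> need not span a face with the apex. The homotopy therefore truncates small
  coordinates and lets weight flow to the apex only when the remaining support has entered
  \<open>L\<close>. \<open>mapping_cone\<close> is a predicate, not a construction: the coned
  complex and the wedge are recognised as mapping cones as they stand, and the comparison maps run
  directly between them. Degenerate complexes need separate care. If \<open>L\<close> is void, no
  apex is added and \<open>M = K\<close>. If \<open>L\<close> has only the empty face,
  \<open>M\<close> is \<open>K\<close> with an isolated point, the suspension is two points, and the
  group of \<open>L\<close> in degree -1 is nonzero. As \<open>K\<close> has a vertex whenever
  \<open>L\<close> is not void, the conventions in degree -1 then concern \<open>L\<close>
  alone.\<close>

abbreviation unit_interval :: "real topology" where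
  "unit_interval \<equiv> top_of_set {0..1}"

section \<open>Disjoint unions as topological sums, and maps out of them\<close>

lemma openin_image_Inl: "openin X U \<Longrightarrow> openin (disjoint_union X Y) (Inl ` U)"
  by (simp add: openin_disjoint_union inj_vimage_image_eq vimage_def image_iff)

lemma openin_image_Inr: "openin Y U \<Longrightarrow> openin (disjoint_union X Y) (Inr ` U)"
  by (simp add: openin_disjoint_union inj_vimage_image_eq vimage_def image_iff)

lemma continuous_map_Inl: "continuous_map X (disjoint_union X Y) Inl"
proof -
  have "{x \<in> topspace X. Inl x \<in> U} = Inl -` U" if "openin (disjoint_union X Y) U" for U
    using that openin_subset by (fastforce simp: openin_disjoint_union)
  then show ?thesis
    by (auto simp: continuous_map_def openin_disjoint_union)
qed

lemma continuous_map_Inr: "continuous_map Y (disjoint_union X Y) Inr"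
proof -
  have "{x \<in> topspace Y. Inr x \<in> U} = Inr -` U" if "openin (disjoint_union X Y) U" for U
    using that openin_subset by (fastforce simp: openin_disjoint_union)
  then show ?thesis
    by (auto simp: continuous_map_def openin_disjoint_union)
qed

lemma compact_space_disjoint_union:
  assumes "compact_space X" "compact_space Y"
  shows "compact_space (disjoint_union X Y)"
proof -
  have "compactin (disjoint_union X Y) (Inl ` topspace X)" "compactin (disjoint_union X Y) (Inr ` topspace Y)"
    using assms unfolding compact_space_def
    by (auto intro: image_compactin[OF _ continuous_map_Inl] image_compactin[OF _ continuous_map_Inr])
  then show ?thesis
    by (simp add: compact_space_def compactin_Un)
qed

lemma continuous_map_from_disjoint_union:
  assumes "continuous_map X T (h \<circ> Inl)" "continuous_map Y T (h \<circ> Inr)"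
  shows "continuous_map (disjoint_union X Y) T h"
proof -
  have "openin (disjoint_union X Y) {z \<in> topspace (disjoint_union X Y). h z \<in> U}" if "openin T U" for U
  proof -
    have "Inl -` {z \<in> topspace (disjoint_union X Y). h z \<in> U} = {x \<in> topspace X. (h \<circ> Inl) x \<in> U}"
      "Inr -` {z \<in> topspace (disjoint_union X Y). h z \<in> U} = {x \<in> topspace Y. (h \<circ> Inr) x \<in> U}"
      by auto
    then show ?thesis
      using assms that by (simp add: openin_disjoint_union openin_continuous_map_preimage del: comp_apply)
  qed
  moreover have "h \<in> topspace (disjoint_union X Y) \<rightarrow> topspace T"
    using assms by (auto simp: continuous_map_def)
  ultimately show ?thesis
    by (simp add: continuous_map_def)
qed

text \<open>Products distribute over disjoint unions: both summands are open, so a rectangle around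
  a point of one summand is already a rectangle of the whole.\<close>

lemma continuous_map_from_prod_disjoint_union:
  assumes l: "continuous_map (prod_topology Z X) T (\<lambda>(t,x). h (t, Inl x))"
    and r: "continuous_map (prod_topology Z Y) T (\<lambda>(t,y). h (t, Inr y))"
  shows "continuous_map (prod_topology Z (disjoint_union X Y)) T h"
  unfolding continuous_map_def
proof (intro conjI allI impI)
  show "h \<in> topspace (prod_topology Z (disjoint_union X Y)) \<rightarrow> topspace T"
    using continuous_map_funspace[OF l] continuous_map_funspace[OF r] by (auto simp: Pi_iff)
  fix U assume U: "openin T U"
  have lo: "openin (prod_topology Z X) {p \<in> topspace (prod_topology Z X). (\<lambda>(t,x). h (t, Inl x)) p \<in> U}"
    using l U by (rule openin_continuous_map_preimage)
  have ro: "openin (prod_topology Z Y) {p \<in> topspace (prod_topology Z Y). (\<lambda>(t,x). h (t, Inr x)) p \<in> U}"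
    using r U by (rule openin_continuous_map_preimage)
  show "openin (prod_topology Z (disjoint_union X Y))
         {p \<in> topspace (prod_topology Z (disjoint_union X Y)). h p \<in> U}"
    unfolding openin_prod_topology_alt
  proof (intro allI impI)
    fix t z
    assume *: "(t, z) \<in> {p \<in> topspace (prod_topology Z (disjoint_union X Y)). h p \<in> U}"
    show "\<exists>V W. openin Z V \<and> openin (disjoint_union X Y) W \<and> t \<in> V \<and> z \<in> W \<and>
         V \<times> W \<subseteq> {p \<in> topspace (prod_topology Z (disjoint_union X Y)). h p \<in> U}"
    proof (cases z)
      case (Inl x)
      then obtain V W where VW: "openin Z V" "openin X W" "t \<in> V" "x \<in> W"
        "V \<times> W \<subseteq> {p \<in> topspace (prod_topology Z X). (\<lambda>(t,x). h (t, Inl x)) p \<in> U}"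
        using lo[unfolded openin_prod_topology_alt, rule_format, of t x] * by auto
      then show ?thesis
        using Inl by (intro exI[of _ V] exI[of _ "Inl ` W"]) (auto simp: openin_image_Inl)
    next
      case (Inr x)
      then obtain V W where VW: "openin Z V" "openin Y W" "t \<in> V" "x \<in> W"
        "V \<times> W \<subseteq> {p \<in> topspace (prod_topology Z Y). (\<lambda>(t,x). h (t, Inr x)) p \<in> U}"
        using ro[unfolded openin_prod_topology_alt, rule_format, of t x] * by auto
      then show ?thesis
        using Inr by (intro exI[of _ V] exI[of _ "Inr ` W"]) (auto simp: openin_image_Inr)
    qed
  qed
qed

text \<open>The unit interval is locally compact and Hausdorff, so the product of \<open>q\<close>
  with its identity is again a quotient map; a homotopy that respects the identifications at each
  time is then continuous on the quotient.\<close>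

lemma homotopy_lift_quotient_map:
  assumes q: "quotient_map X P q"
    and h: "continuous_map (prod_topology unit_interval X) T h"
    and compat: "\<And>t x y. \<lbrakk>t \<in> {0..1}; x \<in> topspace X; y \<in> topspace X; q x = q y\<rbrakk> \<Longrightarrow> h (t,x) = h (t,y)"
  obtains g where "continuous_map (prod_topology unit_interval P) T g"
    "\<And>t x. \<lbrakk>t \<in> {0..1}; x \<in> topspace X\<rbrakk> \<Longrightarrow> g (t, q x) = h (t, x)"
proof -
  have Q: "quotient_map (prod_topology unit_interval X) (prod_topology unit_interval P) (\<lambda>(t,x). (t, q x))"
    by (intro quotient_map_prod_right q disjI1 compact_imp_locally_compact_space)
      (auto simp: Hausdorff_space_subtopology compact_space_subtopology)
  have "h x = h y"
    if "x \<in> topspace (prod_topology unit_interval X)" "y \<in> topspace (prod_topology unit_interval X)"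
      "(\<lambda>(t,x). (t, q x)) x = (\<lambda>(t,x). (t, q x)) y" for x y
    using that compat[of "fst x" "snd x" "snd y"] by (auto simp: case_prod_unfold prod_eq_iff)
  then obtain g where g: "continuous_map (prod_topology unit_interval P) T g"
    "\<And>x. x \<in> topspace (prod_topology unit_interval X) \<Longrightarrow> g ((\<lambda>(t,x). (t, q x)) x) = h x"
    using quotient_map_lift_exists[OF Q h] by metis
  have "g (t, q x) = h (t, x)" if "t \<in> {0..1}" "x \<in> topspace X" for t x
    using g(2)[of "(t, x)"] that by simp
  with g(1) show thesis
    by (rule that)
qed

lemma lift_disjoint_union_quotient_map:
  assumes q: "quotient_map (disjoint_union X Y) P q"
    and h: "continuous_map X T h" "continuous_map Y T k"
    and compat: "\<And>x y. \<lbrakk>x \<in> topspace (disjoint_union X Y); y \<in> topspace (disjoint_union X Y); q x = q y\<rbrakk>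
         \<Longrightarrow> case_sum h k x = case_sum h k y"
  obtains g where "continuous_map P T g"
    "\<And>x. x \<in> topspace X \<Longrightarrow> g (q (Inl x)) = h x" "\<And>y. y \<in> topspace Y \<Longrightarrow> g (q (Inr y)) = k y"
proof -
  have "continuous_map (disjoint_union X Y) T (case_sum h k)"
    by (intro continuous_map_from_disjoint_union) (auto simp: o_def h)
  from quotient_map_lift_exists[OF q this] obtain g where g: "continuous_map P T g"
    "\<And>x. x \<in> topspace (disjoint_union X Y) \<Longrightarrow> g (q x) = case_sum h k x"
    using compat by metis
  show thesis
    using g(2)[of "Inl _"] g(2)[of "Inr _"] by (intro that[OF g(1)]) auto
qed

lemma homotopy_lift_disjoint_union:
  assumes q: "quotient_map (disjoint_union X Y) P q"
    and h: "continuous_map (prod_topology unit_interval X) T h"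
    and k: "continuous_map (prod_topology unit_interval Y) T k"
    and compat: "\<And>t x y. \<lbrakk>t \<in> {0..1}; x \<in> topspace (disjoint_union X Y); y \<in> topspace (disjoint_union X Y); q x = q y\<rbrakk>
         \<Longrightarrow> case_sum (\<lambda>x. h (t,x)) (\<lambda>y. k (t,y)) x = case_sum (\<lambda>x. h (t,x)) (\<lambda>y. k (t,y)) y"
  obtains g where "continuous_map (prod_topology unit_interval P) T g"
    "\<And>t x. \<lbrakk>t \<in> {0..1}; x \<in> topspace X\<rbrakk> \<Longrightarrow> g (t, q (Inl x)) = h (t, x)"
    "\<And>t y. \<lbrakk>t \<in> {0..1}; y \<in> topspace Y\<rbrakk> \<Longrightarrow> g (t, q (Inr y)) = k (t, y)"
proof -
  let ?F = "\<lambda>(t,z). case_sum (\<lambda>x. h (t,x)) (\<lambda>y. k (t,y)) z"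
  have F: "continuous_map (prod_topology unit_interval (disjoint_union X Y)) T ?F"
    by (rule continuous_map_from_prod_disjoint_union)
      (use h k in \<open>simp_all add: case_prod_unfold\<close>)
  have F_compat: "?F (t, x) = ?F (t, y)"
    if "t \<in> {0..1}" "x \<in> topspace (disjoint_union X Y)" "y \<in> topspace (disjoint_union X Y)" "q x = q y" for t x y
    using compat[OF that] by simp
  obtain g where "continuous_map (prod_topology unit_interval P) T g"
    "\<And>t x. \<lbrakk>t \<in> {0..1}; x \<in> topspace (disjoint_union X Y)\<rbrakk> \<Longrightarrow> g (t, q x) = ?F (t, x)"
    using homotopy_lift_quotient_map[OF q F F_compat] by blast
  then show thesis
    by (intro that[of g]) auto
qed

text \<open>The definition of \<open>homotopic_with\<close> prescribes the end maps on the whole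
  type, whereas a lift through a quotient map is controlled only on the space itself; for the
  trivial side condition the latter suffices.\<close>

lemma homotopic_withI_True:
  assumes "continuous_map (prod_topology unit_interval X) Y h"
    "\<And>x. x \<in> topspace X \<Longrightarrow> h (0, x) = f x" "\<And>x. x \<in> topspace X \<Longrightarrow> h (1, x) = g x"
  shows "homotopic_with (\<lambda>_. True) X Y f g"
  using assms by (subst homotopic_with) auto

text \<open>Since \<open>h\<close> ends constant on \<open>A\<close>, its end map factors through
  the quotient as \<open>\<psi>\<close>; since \<open>h\<close> keeps \<open>A\<close> inside
  \<open>A\<close>, the homotopy \<open>\<phi> \<circ> h\<close> descends to the quotient as
  \<open>G\<close>. Then \<open>h\<close> and \<open>G\<close> join the two composites to the
  identities. The quotient of \<open>M\<close> by \<open>A\<close> is presented on \<open>K\<close>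
  alone because \<open>K\<close> and \<open>A\<close> cover \<open>M\<close>.\<close>

lemma homotopy_equivalent_collapse:
  assumes K: "closedin M K" and A: "closedin M A" and KA: "K \<union> A = topspace M"
    and h: "continuous_map (prod_topology unit_interval M) M h"
    and h0: "\<And>b. b \<in> topspace M \<Longrightarrow> h (0, b) = b"
    and hA: "\<And>t b. \<lbrakk>t \<in> {0..1}; b \<in> A\<rbrakk> \<Longrightarrow> h (t, b) \<in> A"
    and h1: "\<And>b. b \<in> A \<Longrightarrow> h (1, b) = e" and e: "e \<in> A"
  shows "M homotopy_equivalent_space collapse (subtopology M K) (K \<inter> A)"
proof -
  define q where "q = case_sum (\<lambda>x. if x \<in> K \<inter> A then None else Some x) (\<lambda>_::unit. None)"
  let ?D = "disjoint_union (subtopology M K) (discrete_topology {()})"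
  let ?C = "collapse (subtopology M K) (K \<inter> A)"
  have tK: "topspace (subtopology M K) = K"
    using K closedin_subset by (auto simp: topspace_subtopology)
  have tD: "topspace ?D = Inl ` K \<union> {Inr ()}"
    using tK by simp
  have AM: "A \<subseteq> topspace M" and KM: "K \<subseteq> topspace M"
    using KA by auto
  have q: "quotient_map ?D ?C q"
    unfolding collapse_def q_def by (rule quotient_map_quotient_topology)
  define \<phi> where "\<phi> b = (if b \<in> A then None else Some b)" for b
  have \<phi>q: "\<phi> b = q (Inl b)" if "b \<in> K" for b
    using that by (simp add: \<phi>_def q_def)
  have tC: "topspace ?C = q ` topspace ?D"
    using quotient_imp_surjective_map[OF q] by (rule sym)
  have cl: "closedin ?C U \<Longrightarrow> closedin (subtopology M K) {b \<in> K. q (Inl b) \<in> U}" for U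
    using closedin_continuous_map_preimage[OF continuous_map_compose[OF continuous_map_Inl quotient_imp_continuous_map[OF q]], of U]
    unfolding tK by simp
  \<comment> \<open>Closed sets are convenient here: a preimage is its trace on \<open>K\<close>,
    closed in \<open>M\<close> because \<open>K\<close> is, together with all of \<open>A\<close> if
    the collapsed point belongs to \<open>U\<close>.\<close>
  have cont\<phi>: "continuous_map M ?C \<phi>"
    unfolding continuous_map_closedin
  proof (intro conjI allI impI)
    show "\<phi> \<in> topspace M \<rightarrow> topspace ?C"
    proof
      fix b assume "b \<in> topspace M"
      then consider "b \<in> A" | "b \<in> K" "b \<notin> A"
        using KA by blast
      then show "\<phi> b \<in> topspace ?C"
        unfolding tC tD by cases (auto simp: \<phi>_def q_def image_iff)
    qed
    fix U assume U: "closedin ?C U"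
    have "closedin M {b \<in> K. q (Inl b) \<in> U}"
      using cl[OF U] closedin_closed_subtopology[OF K] by blast
    moreover have "{b \<in> topspace M. \<phi> b \<in> U} = {b \<in> K. q (Inl b) \<in> U} \<union> (if None \<in> U then A else {})"
      unfolding KA[symmetric] by (auto simp: \<phi>_def q_def split: if_splits)
    ultimately show "closedin M {b \<in> topspace M. \<phi> b \<in> U}"
      using A by auto
  qed
  have ker: "(\<exists>b\<in>K. x = Inl b \<and> y = Inl b) \<or> (x \<in> Inl ` (K \<inter> A) \<union> {Inr ()} \<and> y \<in> Inl ` (K \<inter> A) \<union> {Inr ()})"
    if "x \<in> topspace ?D" "y \<in> topspace ?D" "q x = q y" for x y
    using that unfolding tD by (auto simp: q_def split: if_splits)
  have hK: "continuous_map (prod_topology unit_interval (subtopology M K)) M h"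
    using continuous_map_from_subtopology[OF h, of "UNIV \<times> K"] by (simp add: subtopology_Times)
  have hK1: "continuous_map (subtopology M K) M (\<lambda>b. h (1, b))"
    using continuous_map_o_Pair[OF hK, of 1] by (simp add: o_def)
  have e_const: "continuous_map (discrete_topology {()}) M (\<lambda>_. e)"
    using e AM by auto
  have \<psi>_compat: "case_sum (\<lambda>b. h (1, b)) (\<lambda>_. e) x = case_sum (\<lambda>b. h (1, b)) (\<lambda>_. e) y"
    if "x \<in> topspace ?D" "y \<in> topspace ?D" "q x = q y" for x y
    using ker[OF that] h1 by auto
  obtain \<psi> where cont\<psi>: "continuous_map ?C M \<psi>" and \<psi>': "\<And>b. b \<in> topspace (subtopology M K) \<Longrightarrow> \<psi> (q (Inl b)) = h (1, b)"
    "\<And>u. u \<in> topspace (discrete_topology {()}) \<Longrightarrow> \<psi> (q (Inr u)) = e"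
    using lift_disjoint_union_quotient_map[OF q hK1 e_const \<psi>_compat] by blast
  have \<psi>: "\<And>b. b \<in> K \<Longrightarrow> \<psi> (q (Inl b)) = h (1, b)" "\<psi> (q (Inr ())) = e"
    using \<psi>' unfolding tK by auto
  have "None \<in> topspace ?C"
    unfolding tC tD by (auto simp: q_def image_iff)
  then have None_const: "continuous_map (prod_topology unit_interval (discrete_topology {()})) ?C (\<lambda>_. None)"
    by simp
  have \<phi>h: "continuous_map (prod_topology unit_interval (subtopology M K)) ?C (\<phi> \<circ> h)"
    using continuous_map_compose[OF hK cont\<phi>] .
  have G_compat: "case_sum (\<lambda>b. (\<phi> \<circ> h) (t, b)) (\<lambda>_. None) x = case_sum (\<lambda>b. (\<phi> \<circ> h) (t, b)) (\<lambda>_. None) y"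
    if "t \<in> {0..1}" "x \<in> topspace ?D" "y \<in> topspace ?D" "q x = q y" for t :: real and x y
    using ker[OF that(2-)] hA[OF that(1)] by (auto simp: \<phi>_def)
  obtain G where contG: "continuous_map (prod_topology unit_interval ?C) ?C G"
    and G': "\<And>t b. \<lbrakk>t \<in> {0..1}; b \<in> topspace (subtopology M K)\<rbrakk> \<Longrightarrow> G (t, q (Inl b)) = (\<phi> \<circ> h) (t, b)"
      "\<And>t u. \<lbrakk>t \<in> {0..1}; u \<in> topspace (discrete_topology {()})\<rbrakk> \<Longrightarrow> G (t, q (Inr u)) = None"
    using homotopy_lift_disjoint_union[OF q \<phi>h None_const G_compat] by blast
  have G: "\<And>t b. \<lbrakk>t \<in> {0..1}; b \<in> K\<rbrakk> \<Longrightarrow> G (t, q (Inl b)) = \<phi> (h (t, b))"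
      "\<And>t. t \<in> {0..1} \<Longrightarrow> G (t, q (Inr ())) = None"
    using G' unfolding tK by auto
  have 1: "homotopic_with (\<lambda>_. True) M M id (\<psi> \<circ> \<phi>)"
  proof (rule homotopic_withI_True[OF h])
    fix b assume "b \<in> topspace M"
    then have "b \<in> A \<or> b \<in> K"
      using KA by blast
    then show "h (1, b) = (\<psi> \<circ> \<phi>) b"
      using \<psi>(1)[of b] \<psi>(2) h1[of b] by (cases "b \<in> A") (auto simp: \<phi>_def q_def)
  qed (simp add: h0)
  have 2: "homotopic_with (\<lambda>_. True) ?C ?C id (\<phi> \<circ> \<psi>)"
  proof (rule homotopic_withI_True[OF contG])
    fix c assume "c \<in> topspace ?C"
    then have c: "(\<exists>b\<in>K. c = q (Inl b)) \<or> c = q (Inr ())"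
      unfolding tC tD by auto
    have e': "\<phi> e = None" "q (Inr ()) = None"
      using e by (auto simp: \<phi>_def q_def)
    show "G (1, c) = (\<phi> \<circ> \<psi>) c"
      using c
    proof (elim disjE bexE)
      assume "c = q (Inr ())"
      then show ?thesis
        using G(2)[of 1] \<psi>(2) e' by simp
    qed (simp add: G \<psi>)
    show "G (0, c) = id c"
      using c
    proof (elim disjE bexE)
      assume "c = q (Inr ())"
      then show ?thesis
        using G(2)[of 0] e' by simp
    next
      fix b assume "b \<in> K" "c = q (Inl b)"
      then show ?thesis
        using G(1)[of 0 b] h0[of b] KM \<phi>q by auto
    qed
  qed
  show ?thesis
    unfolding homotopy_equivalent_space_def
    using cont\<phi> cont\<psi> homotopic_with_symD[OF 1] homotopic_with_symD[OF 2] by blast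
qed

section \<open>Mapping cones\<close>

text \<open>
  The base of the cone is at parameter \<open>0\<close>; the apex \<open>z\<close>, at parameter \<open>1\<close>, is a separate summand so
  that the cone over the empty space is a point.
\<close>

definition mapping_cone ::
  "'a topology \<Rightarrow> 'b topology \<Rightarrow> ('a \<Rightarrow> 'b) \<Rightarrow> 'c topology \<Rightarrow> ('b \<Rightarrow> 'c) \<Rightarrow> ('a \<times> real \<Rightarrow> 'c) \<Rightarrow> 'c \<Rightarrow> bool" where
  "mapping_cone A B f P i j z \<longleftrightarrow>
     quotient_map (disjoint_union B (disjoint_union (prod_topology A unit_interval) (discrete_topology {()}))) P
       (case_sum i (case_sum j (\<lambda>_. z))) \<and>
     (\<forall>a\<in>topspace A. j (a, 0) = i (f a) \<and> j (a, 1) = z) \<and>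
     inj_on i (topspace B) \<and> inj_on j (topspace A \<times> {0<..<1}) \<and>
     j ` (topspace A \<times> {0<..<1}) \<inter> i ` topspace B = {} \<and>
     z \<notin> i ` topspace B \<and> z \<notin> j ` (topspace A \<times> {0<..<1})"

lemma mapping_coneD:
  assumes "mapping_cone A B f P i j z"
  shows "continuous_map B P i" "continuous_map (prod_topology A unit_interval) P j" "z \<in> topspace P"
    "topspace P = i ` topspace B \<union> j ` (topspace A \<times> {0..1}) \<union> {z}"
    "a \<in> topspace A \<Longrightarrow> j (a, 0) = i (f a)" "a \<in> topspace A \<Longrightarrow> j (a, 1) = z"
proof -
  let ?D = "disjoint_union (prod_topology A unit_interval) (discrete_topology {()})"
  have q: "quotient_map (disjoint_union B ?D) P (case_sum i (case_sum j (\<lambda>_. z)))"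
    using assms by (simp add: mapping_cone_def)
  note c = quotient_imp_continuous_map[OF q]
  show "continuous_map B P i"
    using continuous_map_compose[OF continuous_map_Inl c] by (simp add: o_def)
  show "continuous_map (prod_topology A unit_interval) P j"
    using continuous_map_compose[OF continuous_map_compose[OF continuous_map_Inl continuous_map_Inr] c]
    by (simp add: o_def)
  show t: "topspace P = i ` topspace B \<union> j ` (topspace A \<times> {0..1}) \<union> {z}"
    using quotient_imp_surjective_map[OF q] by (auto simp: image_Un image_image)
  then show "z \<in> topspace P"
    by simp
  show "a \<in> topspace A \<Longrightarrow> j (a, 0) = i (f a)" "a \<in> topspace A \<Longrightarrow> j (a, 1) = z"
    using assms by (simp_all add: mapping_cone_def)
qed

text \<open>The universal property of a mapping cone, with time as a parameter. Compatibility has to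
  be checked only at the two ends of the cylinder, since the predicate \<open>mapping_cone\<close>
  allows no further identifications.\<close>

lemma mapping_cone_lift_homotopy:
  assumes P: "mapping_cone A B f P i j z" and f: "f \<in> topspace A \<rightarrow> topspace B"
    and k: "continuous_map (prod_topology unit_interval B) T k"
    and l: "continuous_map (prod_topology unit_interval (prod_topology A unit_interval)) T l"
    and w: "w \<in> topspace T"
    and l0: "\<And>t a. \<lbrakk>t \<in> {0..1}; a \<in> topspace A\<rbrakk> \<Longrightarrow> l (t, (a, 0)) = k (t, f a)"
    and l1: "\<And>t a. \<lbrakk>t \<in> {0..1}; a \<in> topspace A\<rbrakk> \<Longrightarrow> l (t, (a, 1)) = w"
  obtains g where "continuous_map (prod_topology unit_interval P) T g"
    "\<And>t b. \<lbrakk>t \<in> {0..1}; b \<in> topspace B\<rbrakk> \<Longrightarrow> g (t, i b) = k (t, b)"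
    "\<And>t a s. \<lbrakk>t \<in> {0..1}; a \<in> topspace A; s \<in> {0..1}\<rbrakk> \<Longrightarrow> g (t, j (a, s)) = l (t, (a, s))"
    "\<And>t. t \<in> {0..1} \<Longrightarrow> g (t, z) = w"
proof -
  let ?E = "disjoint_union (prod_topology A unit_interval) (discrete_topology {()})"
  let ?q = "case_sum i (case_sum j (\<lambda>_::unit. z))"
  let ?m = "\<lambda>(t, y). case_sum (\<lambda>p. l (t, p)) (\<lambda>_::unit. w) y"
  let ?h = "\<lambda>t. case_sum (\<lambda>x. k (t,x)) (\<lambda>y. ?m (t,y))"
  have q: "quotient_map (disjoint_union B ?E) P ?q"
    using P by (simp add: mapping_cone_def)
  have m: "continuous_map (prod_topology unit_interval ?E) T ?m"
    by (rule continuous_map_from_prod_disjoint_union) (use l w in \<open>simp_all add: case_prod_unfold\<close>)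
  \<comment> \<open>Every point of the sum has the image and the value of a normal form: a base
    point, the apex, or a cylinder point with parameter strictly between 0 and 1. The separation
    clauses make equal images come from the same normal form.\<close>
  have norm: "(\<exists>b\<in>topspace B. x = Inl b) \<or> ?q x = z \<and> (\<forall>t\<in>{0..1}. ?h t x = w)
      \<or> (\<exists>b\<in>topspace B. ?q x = i b \<and> (\<forall>t\<in>{0..1}. ?h t x = k (t, b)))
      \<or> (\<exists>p \<in> topspace A \<times> {0<..<1}. x = Inr (Inl p))"
    if "x \<in> topspace (disjoint_union B ?E)" for x
  proof -
    have "(\<exists>b\<in>topspace B. x = Inl b) \<or> (\<exists>a\<in>topspace A. \<exists>s\<in>{0..1}. x = Inr (Inl (a, s))) \<or> x = Inr (Inr ())"
      using that by auto
    then show ?thesis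
    proof (elim disjE bexE)
      fix a s assume as: "a \<in> topspace A" "s \<in> {0..1::real}" "x = Inr (Inl (a, s))"
      consider "s = 0" | "s = 1" | "s \<in> {0<..<1}"
        using as(2) by force
      then show ?thesis
      proof cases
        case 1
        then have "\<exists>b\<in>topspace B. ?q x = i b \<and> (\<forall>t\<in>{0..1}. ?h t x = k (t, b))"
          using as f l0 mapping_coneD(5)[OF P] by (intro bexI[of _ "f a"]) auto
        then show ?thesis by blast
      next
        case 2
        then have "?q x = z \<and> (\<forall>t\<in>{0..1}. ?h t x = w)"
          using as l1 mapping_coneD(6)[OF P] by auto
        then show ?thesis by blast
      qed (use as in auto)
    qed auto
  qed
  have norm': "(\<exists>b\<in>topspace B. ?q x = i b \<and> (\<forall>t\<in>{0..1}. ?h t x = k (t, b)))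
      \<or> ?q x = z \<and> (\<forall>t\<in>{0..1}. ?h t x = w)
      \<or> (\<exists>p \<in> topspace A \<times> {0<..<1}. ?q x = j p \<and> (\<forall>t\<in>{0..1}. ?h t x = l (t, p)))"
    if "x \<in> topspace (disjoint_union B ?E)" for x
    using norm[OF that] by fastforce
  have sep: "inj_on i (topspace B)" "inj_on j (topspace A \<times> {0<..<1})"
    "j ` (topspace A \<times> {0<..<1}) \<inter> i ` topspace B = {}"
    "z \<notin> i ` topspace B" "z \<notin> j ` (topspace A \<times> {0<..<1})"
    using P unfolding mapping_cone_def by blast+
  have compat: "?h t x = ?h t y"
    if "t \<in> {0..1}" "x \<in> topspace (disjoint_union B ?E)" "y \<in> topspace (disjoint_union B ?E)" "?q x = ?q y" for t x y
  proof -
    define qx qy hx hy where defs: "qx = ?q x" "qy = ?q y" "hx = (\<lambda>t. ?h t x)" "hy = (\<lambda>t. ?h t y)"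
    have x: "(\<exists>b\<in>topspace B. qx = i b \<and> hx t = k (t, b)) \<or> qx = z \<and> hx t = w
        \<or> (\<exists>p \<in> topspace A \<times> {0<..<1}. qx = j p \<and> hx t = l (t, p))"
      using norm'[OF that(2)] that(1) unfolding defs by blast
    have y: "(\<exists>b\<in>topspace B. qy = i b \<and> hy t = k (t, b)) \<or> qy = z \<and> hy t = w
        \<or> (\<exists>p \<in> topspace A \<times> {0<..<1}. qy = j p \<and> hy t = l (t, p))"
      using norm'[OF that(3)] that(1) unfolding defs by blast
    have q: "qx = qy"
      using that(4) unfolding defs .
    have "hx t = hy t"
      using x
    proof (elim disjE bexE conjE)
      fix b assume b: "b \<in> topspace B" "qx = i b" "hx t = k (t, b)"
      with y q sep(3,4) obtain b' where "b' \<in> topspace B" "qy = i b'" "hy t = k (t, b')"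
        by auto
      with b q sep(1) show ?thesis
        by (auto dest: inj_onD)
    next
      assume "qx = z" "hx t = w"
      with y q sep(4,5) show ?thesis
        by auto
    next
      fix p assume p: "p \<in> topspace A \<times> {0<..<1}" "qx = j p" "hx t = l (t, p)"
      with y q sep(3,5) obtain p' where "p' \<in> topspace A \<times> {0<..<1}" "qy = j p'" "hy t = l (t, p')"
        by blast
      with p q sep(2) have "p = p'"
        by (metis inj_onD)
      with p \<open>hy t = l (t, p')\<close> show ?thesis
        by simp
    qed
    then show ?thesis
      unfolding defs .
  qed
  obtain g where g: "continuous_map (prod_topology unit_interval P) T g"
    "\<And>t x. \<lbrakk>t \<in> {0..1}; x \<in> topspace B\<rbrakk> \<Longrightarrow> g (t, ?q (Inl x)) = k (t, x)"
    "\<And>t y. \<lbrakk>t \<in> {0..1}; y \<in> topspace ?E\<rbrakk> \<Longrightarrow> g (t, ?q (Inr y)) = ?m (t, y)"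
    using homotopy_lift_disjoint_union[OF q k m compat] by blast
  show thesis
  proof (rule that[OF g(1)])
    show "g (t, i b) = k (t, b)" if "t \<in> {0..1}" "b \<in> topspace B" for t b
      using g(2)[OF that] by simp
    show "g (t, j (a, s)) = l (t, (a, s))" if "t \<in> {0..1}" "a \<in> topspace A" "s \<in> {0..1}" for t a s
      using g(3)[OF that(1), of "Inl (a, s)"] that by simp
    show "g (t, z) = w" if "t \<in> {0..1}" for t
      using g(3)[OF that(1), of "Inr ()"] by simp
  qed
qed

section \<open>Continuity of maps defined piecewise on cylinders\<close>

lemma continuous_map_compose2:
  "\<lbrakk>continuous_map Y Z g; continuous_map X Y f\<rbrakk> \<Longrightarrow> continuous_map X Z (\<lambda>x. g (f x))"
  using continuous_map_compose[of X Y f Z g] by (simp add: o_def)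

lemma continuous_map_into_unit_interval:
  "\<lbrakk>continuous_map X euclideanreal f; \<And>x. x \<in> topspace X \<Longrightarrow> 0 \<le> f x \<and> f x \<le> 1\<rbrakk> \<Longrightarrow> continuous_map X unit_interval f"
  by (auto intro!: continuous_map_into_subtopology)

lemma continuous_map_if_le:
  assumes "continuous_map X euclideanreal p" "continuous_map X euclideanreal q"
    "continuous_map X Y f" "continuous_map X Y g" "\<And>x. \<lbrakk>x \<in> topspace X; p x = q x\<rbrakk> \<Longrightarrow> f x = g x"
  shows "continuous_map X Y (\<lambda>x. if p x \<le> q x then f x else g x)"
  using assms by (intro continuous_map_cases_le continuous_map_from_subtopology) auto

lemma continuous_map_real_fst:
  "continuous_map (prod_topology unit_interval X) euclideanreal fst"
  using continuous_map_fst continuous_map_into_fulltopology by blast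

lemma continuous_map_real_snd_snd:
  "continuous_map (prod_topology Z (prod_topology X unit_interval)) euclideanreal (\<lambda>x. snd (snd x))"
  by (intro continuous_map_compose2[OF continuous_map_into_fulltopology[OF continuous_map_snd] continuous_map_snd])

lemma continuous_map_fst_snd:
  "continuous_map (prod_topology Z (prod_topology X Y)) X (\<lambda>x. fst (snd x))"
  by (intro continuous_map_compose2[OF continuous_map_fst continuous_map_snd])

text \<open>The lower half of each cone segment is spent on following \<open>H\<close> from
  \<open>f a\<close> to \<open>g a\<close> inside the base; the upper half is stretched over the
  whole segment of the other cone.\<close>

lemma mapping_cone_homotopy_map:
  assumes P: "mapping_cone A B f P i j z" and P': "mapping_cone A B g P' i' j' z'"
    and H: "continuous_map (prod_topology unit_interval A) B H"
    and H0: "\<And>a. a \<in> topspace A \<Longrightarrow> H (0, a) = f a" and H1: "\<And>a. a \<in> topspace A \<Longrightarrow> H (1, a) = g a"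
  obtains u where "continuous_map P P' u" "\<And>b. b \<in> topspace B \<Longrightarrow> u (i b) = i' b" "u z = z'"
    "\<And>a s. \<lbrakk>a \<in> topspace A; 0 \<le> s; s \<le> 1/2\<rbrakk> \<Longrightarrow> u (j (a, s)) = i' (H (2 * s, a))"
    "\<And>a s. \<lbrakk>a \<in> topspace A; 1/2 \<le> s; s \<le> 1\<rbrakk> \<Longrightarrow> u (j (a, s)) = j' (a, 2 * s - 1)"
proof -
  note P'D = mapping_coneD[OF P']
  let ?X = "prod_topology unit_interval (prod_topology A unit_interval)"
  \<comment> \<open>The clamps have no effect on the branch where they are evaluated. They make both
    branches continuous on the entire product, as gluing along \<open>snd (snd x) = 1/2\<close>
    requires.\<close>
  define l where "l = (\<lambda>x::real \<times> 'a \<times> real. if snd (snd x) \<le> 1/2 then i' (H (min 1 (2 * snd (snd x)), fst (snd x)))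
       else j' (fst (snd x), max 0 (2 * snd (snd x) - 1)))"
  have f: "f \<in> topspace A \<rightarrow> topspace B"
    using continuous_map_funspace[OF H] H0 by (force simp: Pi_iff)
  have l: "continuous_map ?X P' l"
    unfolding l_def
  proof (rule continuous_map_if_le)
    show "continuous_map ?X P' (\<lambda>x. i' (H (min 1 (2 * snd (snd x)), fst (snd x))))"
      by (intro continuous_map_compose2[OF P'D(1)] continuous_map_compose2[OF H] continuous_map_pairedI
            continuous_map_into_unit_interval continuous_intros continuous_map_real_snd_snd continuous_map_fst_snd) auto
    show "continuous_map ?X P' (\<lambda>x. j' (fst (snd x), max 0 (2 * snd (snd x) - 1)))"
      by (intro continuous_map_compose2[OF P'D(2)] continuous_map_pairedI
            continuous_map_into_unit_interval continuous_intros continuous_map_real_snd_snd continuous_map_fst_snd) auto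
    fix x assume "x \<in> topspace ?X" "snd (snd x) = 1/2"
    then show "i' (H (min 1 (2 * snd (snd x)), fst (snd x))) = j' (fst (snd x), max 0 (2 * snd (snd x) - 1))"
      using H1 P'D(5) by auto
  qed (auto intro: continuous_map_real_snd_snd)
  have k: "continuous_map (prod_topology unit_interval B) P' (\<lambda>x. i' (snd x))"
    by (intro continuous_map_compose2[OF P'D(1)] continuous_map_snd)
  have l0: "l (t, (a, 0)) = i' (snd (t, f a))" if "t \<in> {0..1}" "a \<in> topspace A" for t a
    using that H0 by (simp add: l_def)
  have l1: "l (t, (a, 1)) = z'" if "t \<in> {0..1}" "a \<in> topspace A" for t a
    using that P'D(6) by (simp add: l_def)
  obtain h where h: "continuous_map (prod_topology unit_interval P) P' h"
    "\<And>t b. \<lbrakk>t \<in> {0..1}; b \<in> topspace B\<rbrakk> \<Longrightarrow> h (t, i b) = i' (snd (t, b))"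
    "\<And>t a s. \<lbrakk>t \<in> {0..1}; a \<in> topspace A; s \<in> {0..1}\<rbrakk> \<Longrightarrow> h (t, j (a, s)) = l (t, (a, s))"
    "\<And>t. t \<in> {0..1} \<Longrightarrow> h (t, z) = z'"
    using mapping_cone_lift_homotopy[OF P f k l P'D(3) l0 l1] by blast
  \<comment> \<open>Neither \<open>k\<close> nor \<open>l\<close> depends on the time, so the lifted
    homotopy is used at time 0 as a single map.\<close>
  show thesis
  proof (rule that[of "\<lambda>p. h (0, p)"])
    show "continuous_map P P' (\<lambda>p. h (0, p))"
      using continuous_map_o_Pair[OF h(1), of 0] by (simp add: o_def)
    show "h (0, i b) = i' b" if "b \<in> topspace B" for b
      using h(2)[of 0] that by simp
    show "h (0, z) = z'"
      using h(4) by simp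
    show "h (0, j (a, s)) = i' (H (2 * s, a))" if "a \<in> topspace A" "0 \<le> s" "s \<le> 1/2" for a s
      using h(3)[of 0 a s] that by (simp add: l_def)
    show "h (0, j (a, s)) = j' (a, 2 * s - 1)" if "a \<in> topspace A" "1/2 \<le> s" "s \<le> 1" for a s
    proof (cases "s = 1/2")
      case True
      show ?thesis
        unfolding True using h(3)[of 0 a "1/2"] that(1) H1 P'D(5) by (simp add: l_def)
    next
      case False
      then show ?thesis
        using h(3)[of 0 a s] that by (simp add: l_def)
    qed
  qed
qed

text \<open>On the segment over \<open>a\<close> the composite follows \<open>H\<close> forward up
  to \<open>s = 1/2\<close>, backward up to \<open>s = 3/4\<close>, and then runs through the
  segment at fourfold speed; the constants 2, 3 and 4 in \<open>l\<close> come from these break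
  points. Going out along \<open>H\<close> and back is a loop that can be withdrawn. The other
  composite is the same statement for the reversed homotopy.\<close>

lemma mapping_cone_homotopy_maps_inverse:
  assumes P: "mapping_cone A B f P i j z" and P': "mapping_cone A B g P' i' j' z'"
    and H: "continuous_map (prod_topology unit_interval A) B H"
    and H0: "\<And>a. a \<in> topspace A \<Longrightarrow> H (0, a) = f a"
    and u: "\<And>b. b \<in> topspace B \<Longrightarrow> u (i b) = i' b" "u z = z'"
      "\<And>a s. \<lbrakk>a \<in> topspace A; 0 \<le> s; s \<le> 1/2\<rbrakk> \<Longrightarrow> u (j (a, s)) = i' (H (2 * s, a))"
      "\<And>a s. \<lbrakk>a \<in> topspace A; 1/2 \<le> s; s \<le> 1\<rbrakk> \<Longrightarrow> u (j (a, s)) = j' (a, 2 * s - 1)"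
    and w: "\<And>b. b \<in> topspace B \<Longrightarrow> w (i' b) = i b" "w z' = z"
      "\<And>a s. \<lbrakk>a \<in> topspace A; 0 \<le> s; s \<le> 1/2\<rbrakk> \<Longrightarrow> w (j' (a, s)) = i (H (1 - 2 * s, a))"
      "\<And>a s. \<lbrakk>a \<in> topspace A; 1/2 \<le> s; s \<le> 1\<rbrakk> \<Longrightarrow> w (j' (a, s)) = j (a, 2 * s - 1)"
  shows "homotopic_with (\<lambda>_. True) P P (w \<circ> u) id"
proof -
  note PD = mapping_coneD[OF P]
  let ?X = "prod_topology unit_interval (prod_topology A unit_interval)"
  define l where "l = (\<lambda>x::real \<times> 'a \<times> real. if 4 * snd (snd x) \<le> 3 * fst x
       then i (H (max 0 (min 1 (min (2 * snd (snd x)) (3 * fst x - 4 * snd (snd x)))), fst (snd x)))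
       else j (fst (snd x), max 0 ((4 * snd (snd x) - 3 * fst x) / (4 - 3 * fst x))))"
  \<comment> \<open>At time \<open>t\<close> the path \<open>s \<mapsto> l (t, (a, s))\<close> follows \<open>H\<close> up to \<open>H (t, a)\<close>, returns, and then runs through
    the segment over \<open>a\<close>.\<close>
  have HB: "H (s, a) \<in> topspace B" if "a \<in> topspace A" "0 \<le> s" "s \<le> 1" for s a
    using continuous_map_funspace[OF H] that by (force simp: Pi_iff)
  then have f: "f \<in> topspace A \<rightarrow> topspace B"
    using H0 by force
  have l: "continuous_map ?X P l"
    unfolding l_def
  proof (rule continuous_map_if_le)
    show "continuous_map ?X P (\<lambda>x. i (H (max 0 (min 1 (min (2 * snd (snd x)) (3 * fst x - 4 * snd (snd x)))), fst (snd x))))"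
      by (intro continuous_map_compose2[OF PD(1)] continuous_map_compose2[OF H] continuous_map_pairedI
            continuous_map_into_unit_interval continuous_intros continuous_map_real_snd_snd continuous_map_fst_snd
            continuous_map_real_fst) auto
    show "continuous_map ?X P (\<lambda>x. j (fst (snd x), max 0 ((4 * snd (snd x) - 3 * fst x) / (4 - 3 * fst x))))"
      by (intro continuous_map_compose2[OF PD(2)] continuous_map_pairedI
            continuous_map_into_unit_interval continuous_intros continuous_map_real_snd_snd continuous_map_fst_snd
            continuous_map_real_fst) (auto simp: field_simps)
    fix x assume "x \<in> topspace ?X" "4 * snd (snd x) = 3 * fst x"
    then show "i (H (max 0 (min 1 (min (2 * snd (snd x)) (3 * fst x - 4 * snd (snd x)))), fst (snd x))) =
        j (fst (snd x), max 0 ((4 * snd (snd x) - 3 * fst x) / (4 - 3 * fst x)))"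
      using H0 PD(5) by auto
  qed (intro continuous_intros continuous_map_real_snd_snd continuous_map_real_fst)+
  have k: "continuous_map (prod_topology unit_interval B) P (\<lambda>x. i (snd x))"
    by (intro continuous_map_compose2[OF PD(1)] continuous_map_snd)
  have l0: "l (t, (a, 0)) = i (snd (t, f a))" if "t \<in> {0..1}" "a \<in> topspace A" for t a
    using that H0 by (simp add: l_def)
  have l1: "l (t, (a, 1)) = z" if "t \<in> {0..1}" "a \<in> topspace A" for t a
    using that PD(6) by (simp add: l_def)
  obtain h where h: "continuous_map (prod_topology unit_interval P) P h"
    "\<And>t b. \<lbrakk>t \<in> {0..1}; b \<in> topspace B\<rbrakk> \<Longrightarrow> h (t, i b) = i (snd (t, b))"
    "\<And>t a s. \<lbrakk>t \<in> {0..1}; a \<in> topspace A; s \<in> {0..1}\<rbrakk> \<Longrightarrow> h (t, j (a, s)) = l (t, (a, s))"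
    "\<And>t. t \<in> {0..1} \<Longrightarrow> h (t, z) = z"
    using mapping_cone_lift_homotopy[OF P f k l PD(3) l0 l1] by blast
  have "homotopic_with (\<lambda>_. True) P P id (w \<circ> u)"
  proof (rule homotopic_withI_True[OF h(1)])
    fix p assume "p \<in> topspace P"
    then consider b where "b \<in> topspace B" "p = i b" | "p = z"
      | a s where "a \<in> topspace A" "s \<in> {0..1}" "p = j (a, s)"
      using PD(4) by auto
    then have "h (0, p) = id p \<and> h (1, p) = (w \<circ> u) p"
    proof cases
      case 1
      then show ?thesis using h(2)[of _ b] u w by simp
    next
      case 2
      then show ?thesis using h(4) u w by simp
    next
      case (3 a s)
      \<comment> \<open>At time 0 only \<open>s = 0\<close> falls into the first branch, where
        \<open>H (0, a) = f a\<close> is glued to the bottom of the segment.\<close>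
      have "h (0, p) = p"
        using 3 h(3)[of 0 a s] PD(5)[of a] H0[of a] by (cases "s = 0") (auto simp: l_def)
      moreover have "h (1, p) = w (u p)"
      proof -
        consider "s \<le> 1/2" | "1/2 \<le> s" "s \<le> 3/4" | "3/4 \<le> s"
          by linarith
        then show ?thesis
        proof cases
          assume "s \<le> 1/2"
          then show ?thesis
            using 3 h(3)[of 1 a s] u(3)[of a s] w(1) HB[of a "2 * s"] by (simp add: l_def)
        next
          assume "1/2 \<le> s" "s \<le> 3/4"
          then show ?thesis
            using 3 h(3)[of 1 a s] u(4)[of a s] w(3)[of a "2 * s - 1"] by (simp add: l_def algebra_simps)
        next
          assume "3/4 \<le> s"
          then have "h (1, p) = j (a, 4 * s - 3)"
          proof (cases "s = 3/4")
            case True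
            show ?thesis
              using 3 h(3)[of 1 a "3/4"] PD(5)[of a] H0[of a] unfolding True by (simp add: l_def)
          next
            case False
            then show ?thesis
              using \<open>3/4 \<le> s\<close> 3 h(3)[of 1 a s] by (simp add: l_def)
          qed
          then show ?thesis
            using \<open>3/4 \<le> s\<close> 3 u(4)[of a s] w(4)[of a "2 * s - 1"] by (simp add: algebra_simps)
        qed
      qed
      ultimately show ?thesis by simp
    qed
    then show "h (0, p) = id p" "h (1, p) = (w \<circ> u) p" by auto
  qed
  then show ?thesis
    by (rule homotopic_with_symD)
qed

theorem mapping_cone_homotopy_equivalent:
  assumes P: "mapping_cone A B f P i j z" and P': "mapping_cone A B g P' i' j' z'"
    and fg: "homotopic_with (\<lambda>_. True) A B f g"
  shows "P homotopy_equivalent_space P'"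
proof -
  obtain H where H: "continuous_map (prod_topology unit_interval A) B H"
    and H0: "\<And>a. H (0, a) = f a" and H1: "\<And>a. H (1, a) = g a"
    using fg by (auto simp: homotopic_with_def)
  define H' where "H' = (\<lambda>x. H (1 - fst x, snd x))"
  have H': "continuous_map (prod_topology unit_interval A) B H'"
    unfolding H'_def
    by (intro continuous_map_compose2[OF H] continuous_map_pairedI continuous_map_into_unit_interval
        continuous_intros continuous_map_real_fst) auto
  have H'0: "H' (0, a) = g a" and H'1: "H' (1, a) = f a" for a
    by (auto simp: H'_def H0 H1)
  obtain u where u: "continuous_map P P' u" "\<And>b. b \<in> topspace B \<Longrightarrow> u (i b) = i' b" "u z = z'"
    "\<And>a s. \<lbrakk>a \<in> topspace A; 0 \<le> s; s \<le> 1/2\<rbrakk> \<Longrightarrow> u (j (a, s)) = i' (H (2 * s, a))"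
    "\<And>a s. \<lbrakk>a \<in> topspace A; 1/2 \<le> s; s \<le> 1\<rbrakk> \<Longrightarrow> u (j (a, s)) = j' (a, 2 * s - 1)"
    using mapping_cone_homotopy_map[OF P P' H H0 H1] by blast
  obtain w where w: "continuous_map P' P w" "\<And>b. b \<in> topspace B \<Longrightarrow> w (i' b) = i b" "w z' = z"
    "\<And>a s. \<lbrakk>a \<in> topspace A; 0 \<le> s; s \<le> 1/2\<rbrakk> \<Longrightarrow> w (j' (a, s)) = i (H' (2 * s, a))"
    "\<And>a s. \<lbrakk>a \<in> topspace A; 1/2 \<le> s; s \<le> 1\<rbrakk> \<Longrightarrow> w (j' (a, s)) = j (a, 2 * s - 1)"
    using mapping_cone_homotopy_map[OF P' P H' H'0 H'1] by blast
  have "homotopic_with (\<lambda>_. True) P P (w \<circ> u) id"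
    by (rule mapping_cone_homotopy_maps_inverse[OF P P' H H0 u(2-) w(2,3) _ w(5)])
      (simp_all add: w(4) H'_def)
  moreover have "homotopic_with (\<lambda>_. True) P' P' (u \<circ> w) id"
    by (rule mapping_cone_homotopy_maps_inverse[OF P' P H' H'0 w(2-) u(2,3) _ u(5)])
      (simp_all add: u(4) H'_def)
  ultimately show ?thesis
    unfolding homotopy_equivalent_space_def using u(1) w(1) by blast
qed

section \<open>Suspensions and wedges\<close>

abbreviation suspension_map :: "'a \<times> real + bool \<Rightarrow> 'a \<times> real + bool" where
  "suspension_map \<equiv> case_sum
     (\<lambda>(x, t). if t = 0 then Inr False else if t = 1 then Inr True else Inl (x, t)) Inr"

abbreviation wedge_map :: "'a \<Rightarrow> 'b \<Rightarrow> 'a + 'b \<Rightarrow> 'a + 'b" where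
  "wedge_map x y \<equiv> case_sum Inl (\<lambda>b. if b = y then Inl x else Inr b)"

lemma quotient_map_wedge: "quotient_map (disjoint_union X Y) (wedge X x Y y) (wedge_map x y)"
  unfolding wedge_def by (rule quotient_map_quotient_topology)

lemma quotient_map_suspension:
  "quotient_map (disjoint_union (prod_topology X unit_interval) (discrete_topology UNIV)) (suspension X) suspension_map"
  unfolding suspension_def by (rule quotient_map_quotient_topology)

lemma topspace_suspension_image:
  "topspace (suspension X) = (\<lambda>a. suspension_map (Inl a)) ` (topspace X \<times> {0..1}) \<union> range Inr"
  unfolding suspension_def by (simp add: image_Un image_image)

text \<open>Every point lies on a meridian over some point of \<open>X\<close>, and the meridian is
  followed from parameter 0. The point \<open>x\<close> supplies a meridian between the poles, which
  are not joined when \<open>X\<close> is empty.\<close>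

lemma path_component_of_suspension:
  assumes "x \<in> topspace X" "y \<in> topspace (suspension X)"
  shows "path_component_of (suspension X) (Inr False) y"
proof -
  have "\<exists>a\<in>topspace X. \<exists>s\<in>{0..1}. y = suspension_map (Inl (a, s))"
    using assms(2) unfolding topspace_suspension_image
  proof (elim UnE imageE)
    \<comment> \<open>The pole \<open>Inr b\<close> sits on the meridian over \<open>x\<close> at
      the parameter \<open>of_bool b\<close>.\<close>
    fix b assume "y = Inr b"
    then show ?thesis
      using assms(1) by (intro bexI[of _ x] bexI[of _ "of_bool b"]) (cases b; simp)+
  next
    fix p assume "y = suspension_map (Inl p)" "p \<in> topspace X \<times> {0..1}"
    then show ?thesis
      by (intro bexI[of _ "fst p"] bexI[of _ "snd p"]) auto
  qed
  then obtain a s where a: "a \<in> topspace X" "s \<in> {0..1}" "y = suspension_map (Inl (a, s))"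
    by (elim bexE)
  have "continuous_map unit_interval (suspension X) (\<lambda>t. suspension_map (Inl (a, t * s)))"
    using a(1,2)
    by (intro continuous_map_compose2[OF quotient_imp_continuous_map[OF quotient_map_suspension]]
        continuous_map_compose2[OF continuous_map_Inl] continuous_map_pairedI continuous_map_into_unit_interval
        continuous_intros) (auto simp: mult_le_one)
  then show ?thesis
    unfolding path_component_of_def pathin_def
    using a(3) by (intro exI[of _ "\<lambda>t. suspension_map (Inl (a, t * s))"]) simp
qed

lemma openin_wedge:
  "openin (wedge X x Y y) U \<longleftrightarrow> U \<subseteq> wedge_map x y ` topspace (disjoint_union X Y) \<and>
     openin X {a \<in> topspace X. Inl a \<in> U} \<and> openin Y {b \<in> topspace Y. wedge_map x y (Inr b) \<in> U}"
proof -
  have "Inl -` {p \<in> topspace (disjoint_union X Y). wedge_map x y p \<in> U} = {a \<in> topspace X. Inl a \<in> U}"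
    "Inr -` {p \<in> topspace (disjoint_union X Y). wedge_map x y p \<in> U} = {b \<in> topspace Y. wedge_map x y (Inr b) \<in> U}"
    by auto
  then show ?thesis
    unfolding wedge_def openin_quotient_topology openin_disjoint_union by simp
qed

lemma openin_suspension:
  "openin (suspension X) U \<longleftrightarrow> U \<subseteq> topspace (suspension X) \<and>
     openin (prod_topology X unit_interval) {p \<in> topspace X \<times> {0..1}. suspension_map (Inl p) \<in> U}"
proof -
  let ?D = "disjoint_union (prod_topology X unit_interval) (discrete_topology (UNIV :: bool set))"
  have "Inl -` {p \<in> topspace ?D. suspension_map p \<in> U} = {p \<in> topspace X \<times> {0..1}. suspension_map (Inl p) \<in> U}"
    by auto
  moreover have "topspace (suspension X) = suspension_map ` topspace ?D"
    unfolding suspension_def by simp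
  ultimately show ?thesis
    unfolding suspension_def openin_quotient_topology openin_disjoint_union by simp
qed

text \<open>The pole \<open>Inr True\<close> may serve as the base point only over the empty space: elsewhere the
  cone parameter would have to be reversed.\<close>

lemma mapping_cone_wedge_suspension:
  assumes x: "x \<in> topspace X" and p: "\<not> p \<or> topspace A = {}"
  shows "mapping_cone A X (\<lambda>_. x) (wedge X x (suspension A) (Inr p))
    Inl (\<lambda>a. wedge_map x (Inr p) (Inr (suspension_map (Inl a)))) (Inr (Inr (\<not> p)))"
proof -
  let ?S = "suspension A" and ?W = "wedge X x (suspension A) (Inr p)"
  let ?D = "disjoint_union X (disjoint_union (prod_topology A unit_interval) (discrete_topology {()}))"
  let ?j = "\<lambda>a. wedge_map x (Inr p) (Inr (suspension_map (Inl a)))" and ?z = "Inr (Inr (\<not> p))"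
  let ?q = "case_sum Inl (case_sum ?j (\<lambda>_. ?z))"
  note tS = topspace_suspension_image[of A]
  have tW: "topspace ?W = wedge_map x (Inr p) ` topspace (disjoint_union X ?S)"
    unfolding wedge_def by simp
  have onto: "?q ` topspace ?D = topspace ?W"
  proof -
    have "?q ` topspace ?D = Inl ` topspace X \<union> ?j ` (topspace A \<times> {0..1}) \<union> {?z}"
      by (auto simp: image_Un image_image)
    moreover have "topspace ?W = Inl ` topspace X \<union> ?j ` (topspace A \<times> {0..1}) \<union> (\<lambda>b. wedge_map x (Inr p) (Inr (Inr b))) ` UNIV"
      unfolding tW topspace_disjoint_union tS by (simp add: image_Un image_image Un_assoc)
    moreover have "(\<lambda>b. wedge_map x (Inr p) (Inr (Inr b))) ` UNIV = {Inl x, ?z}"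
      by (auto simp: image_iff UNIV_bool split: if_splits)
    ultimately show ?thesis
      using x by auto
  qed
  \<comment> \<open>Both topologies test \<open>U\<close> by its preimages in \<open>X\<close> and
    in the cylinder; the apex and the poles come from discrete summands and impose no
    condition.\<close>
  have "openin ?D {d \<in> topspace ?D. ?q d \<in> U} = openin ?W U" if U: "U \<subseteq> topspace ?W" for U
  proof -
    let ?U = "{b \<in> topspace ?S. wedge_map x (Inr p) (Inr b) \<in> U}"
    have *: "Inl -` {d \<in> topspace ?D. ?q d \<in> U} = {a \<in> topspace X. Inl a \<in> U}"
      "Inl -` (Inr -` {d \<in> topspace ?D. ?q d \<in> U}) = {a \<in> topspace A \<times> {0..1}. ?j a \<in> U}"
      by auto
    have "openin ?D {d \<in> topspace ?D. ?q d \<in> U} \<longleftrightarrow> openin X {a \<in> topspace X. Inl a \<in> U} \<and>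
        openin (prod_topology A unit_interval) {a \<in> topspace A \<times> {0..1}. ?j a \<in> U}"
      by (simp only: openin_disjoint_union *) auto
    moreover have "{a \<in> topspace A \<times> {0..1}. suspension_map (Inl a) \<in> ?U} = {a \<in> topspace A \<times> {0..1}. ?j a \<in> U}"
      using tS by auto
    ultimately show ?thesis
      unfolding openin_wedge openin_suspension using U tW by simp
  qed
  then have "quotient_map ?D ?W ?q"
    unfolding quotient_map_def using onto by blast
  moreover have "inj_on ?j (topspace A \<times> {0<..<1})"
    by (auto simp: inj_on_def)
  ultimately show ?thesis
    unfolding mapping_cone_def using p by (auto split: if_splits)
qed

section \<open>Maps out of a wedge, and independence of its base point\<close>

lemma wedge_lift_homotopy:
  assumes k: "continuous_map (prod_topology unit_interval X) T k"
    and l: "continuous_map (prod_topology unit_interval Y) T l"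
    and kl: "\<And>t. t \<in> {0..1} \<Longrightarrow> k (t, x) = l (t, y)"
  obtains g where "continuous_map (prod_topology unit_interval (wedge X x Y y)) T g"
    "\<And>t a. \<lbrakk>t \<in> {0..1}; a \<in> topspace X\<rbrakk> \<Longrightarrow> g (t, Inl a) = k (t, a)"
    "\<And>t b. \<lbrakk>t \<in> {0..1}; b \<in> topspace Y\<rbrakk> \<Longrightarrow> g (t, wedge_map x y (Inr b)) = l (t, b)"
proof -
  have compat: "case_sum (\<lambda>a. k (t,a)) (\<lambda>b. l (t,b)) p = case_sum (\<lambda>a. k (t,a)) (\<lambda>b. l (t,b)) p'"
    if "t \<in> {0..1}" "p \<in> topspace (disjoint_union X Y)" "p' \<in> topspace (disjoint_union X Y)"
      "wedge_map x y p = wedge_map x y p'" for t p p'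
    using that(4) kl[OF that(1)] by (cases p; cases p') (auto split: if_splits)
  obtain g where g: "continuous_map (prod_topology unit_interval (wedge X x Y y)) T g"
    "\<And>t a. \<lbrakk>t \<in> {0..1}; a \<in> topspace X\<rbrakk> \<Longrightarrow> g (t, wedge_map x y (Inl a)) = k (t, a)"
    "\<And>t b. \<lbrakk>t \<in> {0..1}; b \<in> topspace Y\<rbrakk> \<Longrightarrow> g (t, wedge_map x y (Inr b)) = l (t, b)"
    using homotopy_lift_disjoint_union[OF quotient_map_wedge k l compat] by blast
  show thesis
    using g(2) by (intro that[OF g(1) _ g(3)]) auto
qed

lemma wedge_lift:
  assumes k: "continuous_map X T k" and l: "continuous_map Y T l" and kl: "k x = l y"
  obtains g where "continuous_map (wedge X x Y y) T g"
    "\<And>a. a \<in> topspace X \<Longrightarrow> g (Inl a) = k a" "\<And>b. b \<in> topspace Y \<Longrightarrow> g (wedge_map x y (Inr b)) = l b"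
proof -
  have compat: "case_sum k l p = case_sum k l p'"
    if "p \<in> topspace (disjoint_union X Y)" "p' \<in> topspace (disjoint_union X Y)"
      "wedge_map x y p = wedge_map x y p'" for p p'
    using that(3) kl by (cases p; cases p') (auto split: if_splits)
  obtain g where g: "continuous_map (wedge X x Y y) T g"
    "\<And>a. a \<in> topspace X \<Longrightarrow> g (wedge_map x y (Inl a)) = k a"
    "\<And>b. b \<in> topspace Y \<Longrightarrow> g (wedge_map x y (Inr b)) = l b"
    using lift_disjoint_union_quotient_map[OF quotient_map_wedge k l compat] by blast
  show thesis
    using g(2) by (intro that[OF g(1) _ g(3)]) auto
qed

lemma continuous_map_wedge_Inl: "continuous_map X (wedge X x Y y) Inl"
  using continuous_map_compose[OF continuous_map_Inl quotient_imp_continuous_map[OF quotient_map_wedge]]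
  by (simp add: o_def)

lemma continuous_map_wedge_Inr: "continuous_map Y (wedge X x Y y) (\<lambda>b. wedge_map x y (Inr b))"
  using continuous_map_compose[OF continuous_map_Inr quotient_imp_continuous_map[OF quotient_map_wedge]]
  by (simp add: o_def)

lemma topspace_wedge:
  "topspace (wedge X x Y y) = Inl ` topspace X \<union> (\<lambda>b. wedge_map x y (Inr b)) ` topspace Y"
  unfolding wedge_def by (simp add: image_Un image_image)

text \<open>A neighbourhood of \<open>x\<close> contracts to \<open>x\<close>, in a form that is easy to paste: at time \<open>1\<close> the homotopy
  has collapsed \<open>{a. m a \<ge> 1/2}\<close>, which leaves room for a path on the values of \<open>m\<close> from \<open>1/2\<close> to \<open>1\<close>.\<close>

definition well_pointed :: "'a topology \<Rightarrow> 'a \<Rightarrow> bool" where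
  "well_pointed X x \<longleftrightarrow> x \<in> topspace X \<and>
     (\<exists>m E. continuous_map X euclideanreal m \<and> (\<forall>a\<in>topspace X. m a \<le> 1) \<and> m x = 1 \<and>
        continuous_map (prod_topology unit_interval X) X E \<and> (\<forall>a\<in>topspace X. E (0, a) = a) \<and>
        (\<forall>t\<in>{0..1}. E (t, x) = x) \<and>
        (\<forall>t\<in>{0..1}. \<forall>a\<in>topspace X. 1 \<le> 2 * t * m a \<longrightarrow> E (t, a) = x))"

text \<open>Both maps spread the collar \<open>m a \<ge> 1/2\<close> of \<open>x\<close> along the
  path between the base points and apply \<open>E\<close> at time 1 elsewhere; the formulas meet
  because \<open>E (1, a) = x\<close> at the edge of the collar. The two passages along the path
  cancel up to homotopy, and what is left on \<open>X\<close> is isotopic in time to the identity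
  through \<open>E\<close>.\<close>

lemma wedge_slide_basepoint_inverse:
  assumes x: "x \<in> topspace X"
    and m: "continuous_map X euclideanreal m" "\<And>a. a \<in> topspace X \<Longrightarrow> m a \<le> 1" "m x = 1"
    and E: "continuous_map (prod_topology unit_interval X) X E" "\<And>a. a \<in> topspace X \<Longrightarrow> E (0, a) = a"
      "\<And>t. t \<in> {0..1} \<Longrightarrow> E (t, x) = x"
      "\<And>t a. \<lbrakk>t \<in> {0..1}; a \<in> topspace X; 1 \<le> 2 * t * m a\<rbrakk> \<Longrightarrow> E (t, a) = x"
    and \<delta>: "continuous_map unit_interval Y \<delta>" "\<delta> 0 = y'" "\<delta> 1 = y"
    and \<alpha>: "\<And>a. a \<in> topspace X \<Longrightarrow> \<alpha> (Inl a) = (if 2 * m a \<le> 1 then Inl (E (1, a)) else wedge_map x y' (Inr (\<delta> (2 * m a - 1))))"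
      "\<And>b. b \<in> topspace Y \<Longrightarrow> \<alpha> (wedge_map x y (Inr b)) = wedge_map x y' (Inr b)"
    and \<beta>: "\<And>a. a \<in> topspace X \<Longrightarrow> \<beta> (Inl a) = (if 2 * m a \<le> 1 then Inl (E (1, a)) else wedge_map x y (Inr (\<delta> (2 - 2 * m a))))"
      "\<And>b. b \<in> topspace Y \<Longrightarrow> \<beta> (wedge_map x y' (Inr b)) = wedge_map x y (Inr b)"
  shows "homotopic_with (\<lambda>_. True) (wedge X x Y y) (wedge X x Y y) (\<beta> \<circ> \<alpha>) id"
proof -
  let ?W = "wedge X x Y y" and ?I = "prod_topology unit_interval X"
  define \<iota> where "\<iota> = (\<lambda>b. wedge_map x y (Inr b))"
  define e where "e = (\<lambda>a. E (1, a))"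
  have \<iota>: "continuous_map Y ?W \<iota>" "\<iota> y = Inl x"
    unfolding \<iota>_def by (rule continuous_map_wedge_Inr) simp
  have EX: "E (t, a) \<in> topspace X" if "t \<in> {0..1}" "a \<in> topspace X" for t a
    using continuous_map_funspace[OF E(1)] that by (force simp: Pi_iff)
  have e: "continuous_map X X e"
    unfolding e_def using continuous_map_o_Pair[OF E(1), of 1] by (simp add: o_def)
  have \<delta>Y: "\<delta> s \<in> topspace Y" if "0 \<le> s" "s \<le> 1" for s
    using continuous_map_funspace[OF \<delta>(1)] that by (force simp: Pi_iff)
  have eX: "e a \<in> topspace X" if "a \<in> topspace X" for a
    using EX[of 1] that by (simp add: e_def)
  have ex: "e a = x" if "a \<in> topspace X" "1 \<le> 2 * m a" for a
    using E(4)[of 1] that by (simp add: e_def)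
  have mf: "continuous_map ?I euclideanreal (\<lambda>p. m (snd p))"
    by (intro continuous_map_compose2[OF m(1)] continuous_map_snd)
  have mef: "continuous_map ?I euclideanreal (\<lambda>p. m (e (snd p)))"
    by (intro continuous_map_compose2[OF m(1)] continuous_map_compose2[OF e] continuous_map_snd)
  have l: "continuous_map (prod_topology unit_interval Y) ?W (\<lambda>p. \<iota> (snd p))"
    by (intro continuous_map_compose2[OF \<iota>(1)] continuous_map_snd)
  \<comment> \<open>The composite drags \<open>x\<close> along \<open>\<delta>\<close> and back. At time \<open>t\<close> only the part of \<open>\<delta>\<close> over \<open>[t, 1]\<close> is
    used; what remains at time \<open>1\<close> is \<open>e \<circ> e\<close>.\<close>
  define k1 where "k1 = (\<lambda>p. if 2 * m (e (snd p)) \<le> 1 then Inl (e (e (snd p)))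
       else \<iota> (\<delta> (1 - (1 - fst p) * max 0 (2 * m (e (snd p)) - 1))))"
  define k2 where "k2 = (\<lambda>p. \<iota> (\<delta> (fst p + (1 - fst p) * max 0 (2 * m (snd p) - 1))))"
  have bnd: "0 \<le> (1 - t) * max 0 (2 * m a - 1)" "(1 - t) * max 0 (2 * m a - 1) \<le> 1 - t"
    if "t \<in> {0..1}" "a \<in> topspace X" for t a
    using that m(2)[of a] by (auto intro!: mult_left_le)
  have k1: "continuous_map ?I ?W k1"
    unfolding k1_def
  proof (rule continuous_map_if_le)
    show "continuous_map ?I ?W (\<lambda>p. Inl (e (e (snd p))))"
      by (intro continuous_map_compose2[OF continuous_map_wedge_Inl] continuous_map_compose2[OF e] continuous_map_snd)
    show "continuous_map ?I ?W (\<lambda>p. \<iota> (\<delta> (1 - (1 - fst p) * max 0 (2 * m (e (snd p)) - 1))))"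
    proof (intro continuous_map_compose2[OF \<iota>(1)] continuous_map_compose2[OF \<delta>(1)]
        continuous_map_into_unit_interval continuous_intros mef continuous_map_real_fst)
      fix p assume "p \<in> topspace ?I"
      then show "0 \<le> 1 - (1 - fst p) * max 0 (2 * m (e (snd p)) - 1) \<and> 1 - (1 - fst p) * max 0 (2 * m (e (snd p)) - 1) \<le> 1"
        using bnd[of "fst p" "e (snd p)"] eX by auto
    qed simp_all
    fix p assume "p \<in> topspace ?I" "2 * m (e (snd p)) = 1"
    then show "Inl (e (e (snd p))) = \<iota> (\<delta> (1 - (1 - fst p) * max 0 (2 * m (e (snd p)) - 1)))"
      using ex eX \<delta> \<iota> by auto
  qed (intro continuous_intros mef)+
  have k2: "continuous_map ?I ?W k2"
    unfolding k2_def
  proof (intro continuous_map_compose2[OF \<iota>(1)] continuous_map_compose2[OF \<delta>(1)]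
      continuous_map_into_unit_interval continuous_intros mf continuous_map_real_fst)
    fix p assume "p \<in> topspace ?I"
    then show "0 \<le> fst p + (1 - fst p) * max 0 (2 * m (snd p) - 1) \<and> fst p + (1 - fst p) * max 0 (2 * m (snd p) - 1) \<le> 1"
      using bnd[of "fst p" "snd p"] by auto
  qed simp_all
  have k: "continuous_map ?I ?W (\<lambda>p. if 2 * m (snd p) \<le> 1 then k1 p else k2 p)"
  proof (rule continuous_map_if_le[OF _ _ k1 k2])
    \<comment> \<open>At the edge of the collar \<open>e\<close> has already reached
      \<open>x\<close>, where \<open>m\<close> is 1, so both formulas give the point of
      \<open>\<delta>\<close> at time \<open>fst p\<close>.\<close>
    fix p assume "p \<in> topspace ?I" "2 * m (snd p) = 1"
    then show "k1 p = k2 p"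
      using ex[of "snd p"] m(3) by (auto simp: k1_def k2_def)
  qed (intro continuous_intros mf)+
  have kx: "(if 2 * m (snd (t, x)) \<le> 1 then k1 (t, x) else k2 (t, x)) = \<iota> (snd (t, y))" if "t \<in> {0..1}" for t :: real
    by (simp add: k2_def m(3) \<delta>)
  obtain g where g: "continuous_map (prod_topology unit_interval ?W) ?W g"
    "\<And>t a. \<lbrakk>t \<in> {0..1}; a \<in> topspace X\<rbrakk> \<Longrightarrow> g (t, Inl a) = (if 2 * m (snd (t, a)) \<le> 1 then k1 (t, a) else k2 (t, a))"
    "\<And>t b. \<lbrakk>t \<in> {0..1}; b \<in> topspace Y\<rbrakk> \<Longrightarrow> g (t, wedge_map x y (Inr b)) = \<iota> (snd (t, b))"
    using wedge_lift_homotopy[OF k l kx] by blast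
  \<comment> \<open>Applying \<open>E\<close> twice with the same time joins the identity to
    \<open>e \<circ> e\<close> and fixes \<open>x\<close>, hence extends by the identity of
    \<open>Y\<close>.\<close>
  have k': "continuous_map ?I ?W (\<lambda>p. Inl (E (fst p, E p)))"
    by (intro continuous_map_compose2[OF continuous_map_wedge_Inl] continuous_map_compose2[OF E(1)]
        continuous_map_pairedI continuous_map_fst E(1))
  have k'x: "Inl (E (fst (t, x), E (t, x))) = \<iota> (snd (t, y))" if "t \<in> {0..1}" for t
    using that by (simp add: E \<iota>)
  obtain h where h: "continuous_map (prod_topology unit_interval ?W) ?W h"
    "\<And>t a. \<lbrakk>t \<in> {0..1}; a \<in> topspace X\<rbrakk> \<Longrightarrow> h (t, Inl a) = Inl (E (fst (t, a), E (t, a)))"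
    "\<And>t b. \<lbrakk>t \<in> {0..1}; b \<in> topspace Y\<rbrakk> \<Longrightarrow> h (t, wedge_map x y (Inr b)) = \<iota> (snd (t, b))"
    using wedge_lift_homotopy[OF k' l k'x] by blast
  have pts: "(\<exists>a\<in>topspace X. p = Inl a) \<or> (\<exists>b\<in>topspace Y. p = \<iota> b)" if "p \<in> topspace ?W" for p
    using that unfolding topspace_wedge \<iota>_def by auto
  have "homotopic_with (\<lambda>_. True) ?W ?W (\<beta> \<circ> \<alpha>) (\<lambda>p. h (1, p))"
  proof (rule homotopic_withI_True[OF g(1)])
    fix p assume "p \<in> topspace ?W"
    from pts[OF this] show "g (0, p) = (\<beta> \<circ> \<alpha>) p"
    proof (elim disjE bexE)
      fix a assume a: "a \<in> topspace X" "p = Inl a"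
      show ?thesis
      proof (cases "2 * m a \<le> 1")
        case True
        then show ?thesis
          using a g(2)[of 0 a] \<alpha>(1) \<beta>(1)[of "e a"] eX[of a] by (simp add: k1_def \<iota>_def e_def)
      next
        case False
        then have "\<delta> (2 * m a - 1) \<in> topspace Y"
          using \<delta>Y m(2) a by auto
        with False show ?thesis
          using a g(2)[of 0 a] \<alpha>(1) \<beta>(2) by (simp add: k2_def \<iota>_def del: sum.case)
      qed
    next
      fix b assume b: "b \<in> topspace Y" "p = \<iota> b"
      then show ?thesis
        using g(3)[of 0 b] \<alpha>(2) \<beta>(2) by (simp add: \<iota>_def del: sum.case)
    qed
    from pts[OF \<open>p \<in> topspace ?W\<close>] show "g (1, p) = h (1, p)"
    proof (elim disjE bexE)
      fix a assume a: "a \<in> topspace X" "p = Inl a"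
      have "h (1, p) = Inl (e (e a))"
        using a h(2)[of 1 a] by (simp add: e_def)
      moreover have "k1 (1, a) = Inl (e (e a))"
        using ex[of "e a"] eX a \<delta> \<iota> by (simp add: k1_def)
      moreover have "k2 (1, a) = Inl (e (e a))" if "1 < 2 * m a"
        using ex[of a] ex[of x] that x a \<delta> \<iota> m(3) by (simp add: k2_def)
      ultimately show ?thesis
        using a g(2)[of 1 a] by simp
    next
      fix b assume b: "b \<in> topspace Y" "p = \<iota> b"
      then show ?thesis
        using g(3)[of 1 b] h(3)[of 1 b] by (simp add: \<iota>_def del: sum.case)
    qed
  qed
  moreover have "homotopic_with (\<lambda>_. True) ?W ?W id (\<lambda>p. h (1, p))"
  proof (rule homotopic_withI_True[OF h(1)])
    fix p assume "p \<in> topspace ?W"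
    from pts[OF this] show "h (0, p) = id p"
    proof (elim disjE bexE)
      fix a assume a: "a \<in> topspace X" "p = Inl a"
      then show ?thesis
        using h(2)[of 0 a] E(2) by simp
    next
      fix b assume b: "b \<in> topspace Y" "p = \<iota> b"
      then show ?thesis
        using h(3)[of 0 b] by (simp add: \<iota>_def del: sum.case)
    qed
  qed simp
  ultimately show ?thesis
    using homotopic_with_trans homotopic_with_symD by blast
qed

text \<open>Being well pointed plays the part of the homotopy extension property: the neighbourhood
  of \<open>x\<close> absorbs the path in \<open>Y\<close>, so nothing is asked of \<open>Y\<close>
  near its base points.\<close>

lemma wedge_change_basepoint:
  assumes X: "well_pointed X x" and Y: "path_component_of Y y' y"
  shows "wedge X x Y y homotopy_equivalent_space wedge X x Y y'"
proof -
  obtain m E where x: "x \<in> topspace X"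
    and m: "continuous_map X euclideanreal m" "\<And>a. a \<in> topspace X \<Longrightarrow> m a \<le> 1" "m x = 1"
    and E: "continuous_map (prod_topology unit_interval X) X E" "\<And>a. a \<in> topspace X \<Longrightarrow> E (0, a) = a"
      "\<And>t. t \<in> {0..1} \<Longrightarrow> E (t, x) = x"
      "\<And>t a. \<lbrakk>t \<in> {0..1}; a \<in> topspace X; 1 \<le> 2 * t * m a\<rbrakk> \<Longrightarrow> E (t, a) = x"
    using X unfolding well_pointed_def by blast
  have E1: "continuous_map X X (\<lambda>a. E (1, a))"
    using continuous_map_o_Pair[OF E(1), of 1] by (simp add: o_def)
  obtain \<delta> where \<delta>: "continuous_map unit_interval Y \<delta>" "\<delta> 0 = y'" "\<delta> 1 = y"
    using Y unfolding path_component_of_def pathin_def by blast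
  \<comment> \<open>One construction yields both maps: \<open>\<alpha>\<close> from the path
    \<open>\<delta>\<close>, \<open>\<beta>\<close> from its reverse.\<close>
  have slide: "\<exists>\<alpha>. continuous_map (wedge X x Y y2) (wedge X x Y y1) \<alpha> \<and>
      (\<forall>a\<in>topspace X. \<alpha> (Inl a) = (if 2 * m a \<le> 1 then Inl (E (1, a)) else wedge_map x y1 (Inr (\<epsilon> (2 * m a - 1))))) \<and>
      (\<forall>b\<in>topspace Y. \<alpha> (wedge_map x y2 (Inr b)) = wedge_map x y1 (Inr b))"
    if \<epsilon>: "continuous_map unit_interval Y \<epsilon>" "\<epsilon> 0 = y1" "\<epsilon> 1 = y2" for \<epsilon> y1 y2
  proof -
    let ?k = "\<lambda>a. if 2 * m a \<le> 1 then Inl (E (1, a)) else wedge_map x y1 (Inr (\<epsilon> (max 0 (2 * m a - 1))))"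
    have k: "continuous_map X (wedge X x Y y1) ?k"
    proof (rule continuous_map_if_le)
      show "continuous_map X (wedge X x Y y1) (\<lambda>a. Inl (E (1, a)))"
        by (intro continuous_map_compose2[OF continuous_map_wedge_Inl] E1)
      show "continuous_map X (wedge X x Y y1) (\<lambda>a. wedge_map x y1 (Inr (\<epsilon> (max 0 (2 * m a - 1)))))"
        using m(2)
        by (intro continuous_map_compose2[OF continuous_map_wedge_Inr] continuous_map_compose2[OF \<epsilon>(1)]
            continuous_map_into_unit_interval continuous_intros m(1)) auto
      fix a assume "a \<in> topspace X" "2 * m a = 1"
      then show "Inl (E (1, a)) = wedge_map x y1 (Inr (\<epsilon> (max 0 (2 * m a - 1))))"
        using E(4)[of 1 a] \<epsilon> by simp
    qed (intro continuous_intros m(1))+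
    have kx: "?k x = wedge_map x y1 (Inr y2)"
      using m(3) \<epsilon> by simp
    obtain g where g: "continuous_map (wedge X x Y y2) (wedge X x Y y1) g"
      "\<And>a. a \<in> topspace X \<Longrightarrow> g (Inl a) = ?k a"
      "\<And>b. b \<in> topspace Y \<Longrightarrow> g (wedge_map x y2 (Inr b)) = wedge_map x y1 (Inr b)"
      using wedge_lift[OF k continuous_map_wedge_Inr kx] by blast
    show ?thesis
    proof (intro exI[of _ g] conjI ballI g(1,3))
      fix a assume "a \<in> topspace X"
      then show "g (Inl a) = (if 2 * m a \<le> 1 then Inl (E (1, a)) else wedge_map x y1 (Inr (\<epsilon> (2 * m a - 1))))"
        using g(2)[of a] by (simp add: max_absorb2)
    qed
  qed
  have \<delta>': "continuous_map unit_interval Y (\<lambda>s. \<delta> (1 - s))"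
    by (intro continuous_map_compose2[OF \<delta>(1)] continuous_map_into_unit_interval continuous_intros) auto
  obtain \<alpha> where \<alpha>: "continuous_map (wedge X x Y y) (wedge X x Y y') \<alpha>"
    "\<And>a. a \<in> topspace X \<Longrightarrow> \<alpha> (Inl a) = (if 2 * m a \<le> 1 then Inl (E (1, a)) else wedge_map x y' (Inr (\<delta> (2 * m a - 1))))"
    "\<And>b. b \<in> topspace Y \<Longrightarrow> \<alpha> (wedge_map x y (Inr b)) = wedge_map x y' (Inr b)"
    using slide[OF \<delta>] by blast
  obtain \<beta> where \<beta>: "continuous_map (wedge X x Y y') (wedge X x Y y) \<beta>"
    "\<And>a. a \<in> topspace X \<Longrightarrow> \<beta> (Inl a) = (if 2 * m a \<le> 1 then Inl (E (1, a)) else wedge_map x y (Inr (\<delta> (1 - (2 * m a - 1)))))"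
    "\<And>b. b \<in> topspace Y \<Longrightarrow> \<beta> (wedge_map x y' (Inr b)) = wedge_map x y (Inr b)"
    using slide[OF \<delta>', of y y'] \<delta>(2,3) by (auto simp del: sum.case if_split)
  have 1: "homotopic_with (\<lambda>_. True) (wedge X x Y y) (wedge X x Y y) (\<beta> \<circ> \<alpha>) id"
    by (rule wedge_slide_basepoint_inverse[OF x m E \<delta> \<alpha>(2,3) _ \<beta>(3)]) (simp_all add: \<beta>(2))
  have 2: "homotopic_with (\<lambda>_. True) (wedge X x Y y') (wedge X x Y y') (\<alpha> \<circ> \<beta>) id"
    by (rule wedge_slide_basepoint_inverse[OF x m E \<delta>' _ _ \<beta>(2,3) _ \<alpha>(3)]) (simp_all add: \<alpha>(2) \<delta>)
  show ?thesis
    unfolding homotopy_equivalent_space_def using \<alpha>(1) \<beta>(1) 1 2 by blast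
qed

section \<open>Realizations of finite complexes\<close>

abbreviation support :: "('a \<Rightarrow> real) \<Rightarrow> 'a set" where
  "support b \<equiv> {x. b x \<noteq> 0}"

definition vertex :: "'a \<Rightarrow> 'a \<Rightarrow> real" where
  "vertex v = (\<lambda>x. if x = v then 1 else 0)"

lemma topspace_realization:
  "topspace (realization K) =
     {b. (\<forall>x. 0 \<le> b x) \<and> finite (support b) \<and> support b \<in> K \<and> (\<Sum>x | b x \<noteq> 0. b x) = 1}"
  by (simp add: realization_def)

lemma support_in_complex: "b \<in> topspace (realization K) \<Longrightarrow> support b \<in> K"
  by (simp add: topspace_realization)

lemma realization_nonneg: "b \<in> topspace (realization K) \<Longrightarrow> 0 \<le> b x"
  by (simp add: topspace_realization)

lemma support_nonempty:
  assumes "b \<in> topspace (realization K)"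
  shows "support b \<noteq> {}"
proof
  assume "support b = {}"
  then have "(\<Sum>x | b x \<noteq> 0. b x) = 0"
    by (simp only: sum.empty)
  with assms show False
    by (simp add: topspace_realization)
qed

lemma topspace_realization_subset_iff:
  "b \<in> topspace (realization K) \<Longrightarrow> b \<in> topspace (realization L) \<longleftrightarrow> support b \<in> L"
  by (simp add: topspace_realization)

lemma continuous_map_realization_iff:
  "continuous_map X (realization K) f \<longleftrightarrow>
     (\<forall>i. continuous_map X euclideanreal (\<lambda>x. f x i)) \<and> (\<forall>x\<in>topspace X. f x \<in> topspace (realization K))"
proof -
  have "topspace (realization K) = {b. (\<forall>x. 0 \<le> b x) \<and> finite (support b) \<and> support b \<in> K \<and> (\<Sum>x | b x \<noteq> 0. b x) = 1}"
    by (rule topspace_realization)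
  then show ?thesis
    unfolding realization_def by (auto simp: continuous_map_in_subtopology continuous_map_componentwise_UNIV)
qed

lemma continuous_map_realization_coordinate [continuous_intros]:
  "continuous_map (realization K) euclideanreal (\<lambda>b. b i)"
  using continuous_map_realization_iff[of "realization K" K "\<lambda>b. b"] by simp

lemma continuous_map_realization_coordinate2:
  "continuous_map X (realization K) f \<Longrightarrow> continuous_map X euclideanreal (\<lambda>x. f x i)"
  by (simp add: continuous_map_realization_iff)

lemma realization_subcomplex:
  assumes "L \<subseteq> K"
  shows "realization L = subtopology (realization K) (topspace (realization L))"
proof -
  have "topspace (realization L) \<subseteq> topspace (realization K)"
    using assms by (auto simp: topspace_realization)
  then show ?thesis
    unfolding topspace_realization unfolding realization_def by (simp add: subtopology_subtopology inf.absorb2)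
qed

lemma Hausdorff_space_realization: "Hausdorff_space (realization K)"
  unfolding realization_def by (intro Hausdorff_space_subtopology) (simp add: Hausdorff_space_product_topology)

lemma topspace_realization_mono: "L \<subseteq> K \<Longrightarrow> topspace (realization L) \<subseteq> topspace (realization K)"
  by (auto simp: topspace_realization)

locale finite_complex =
  fixes V :: "'a set" and K :: "'a set set"
  assumes finite_vertices: "finite V" and faces: "K \<subseteq> Pow V"
    and face_subset: "\<And>F F'. \<lbrakk>F \<in> K; F' \<subseteq> F\<rbrakk> \<Longrightarrow> F' \<in> K"
begin

lemma mem_realization:
  "b \<in> topspace (realization K) \<longleftrightarrow> (\<forall>x. 0 \<le> b x) \<and> support b \<in> K \<and> sum b V = 1"
proof -
  have "finite (support b) \<and> (\<Sum>x | b x \<noteq> 0. b x) = sum b V" if "support b \<in> K"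
  proof -
    have "support b \<subseteq> V"
      using that faces by blast
    then show ?thesis
      using finite_vertices by (auto simp: finite_subset intro!: sum.mono_neutral_left)
  qed
  then show ?thesis
    by (auto simp: topspace_realization)
qed

lemma realization_le_1: "b \<in> topspace (realization K) \<Longrightarrow> b x \<le> 1"
proof -
  assume b: "b \<in> topspace (realization K)"
  show "b x \<le> 1"
  proof (cases "x \<in> V")
    case True
    then show ?thesis
      using b member_le_sum[of x V b] finite_vertices by (auto simp: mem_realization)
  next
    case False
    then have "b x = 0"
      using b faces by (auto simp: mem_realization)
    then show ?thesis by simp
  qed
qed

lemma vertex_in_realization: "{x} \<in> K \<Longrightarrow> vertex x \<in> topspace (realization K)"
proof -
  assume x: "{x} \<in> K"
  then have "x \<in> V"
    using faces by blast
  moreover have "support (vertex x) = {x}"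
    by (auto simp: vertex_def)
  ultimately show ?thesis
    using x finite_vertices by (auto simp: mem_realization vertex_def)
qed

lemma normalise_in_realization:
  assumes "\<And>x. 0 \<le> w x" "support w \<in> K" "sum w V > 0"
  shows "(\<lambda>x. w x / sum w V) \<in> topspace (realization K)"
proof -
  have "support (\<lambda>x. w x / sum w V) = support w"
    using assms(3) by auto
  then show ?thesis
    using assms by (auto simp: mem_realization sum_divide_distrib[symmetric])
qed

lemma convex_combination_in_realization:
  assumes b: "b \<in> topspace (realization K)" "c \<in> topspace (realization K)" and u: "0 \<le> u" "u \<le> 1"
    and K: "0 < u \<Longrightarrow> support b \<union> support c \<in> K"
  shows "(\<lambda>i. (1 - u) * b i + u * c i) \<in> topspace (realization K)"
proof (cases "u = 0")
  case False
  have "support (\<lambda>i. (1 - u) * b i + u * c i) \<subseteq> support b \<union> support c"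
    by auto
  moreover have "support b \<union> support c \<in> K"
    using K u False by simp
  ultimately have "support (\<lambda>i. (1 - u) * b i + u * c i) \<in> K"
    using face_subset by blast
  then show ?thesis
    using b u by (simp add: mem_realization sum.distrib flip: sum_distrib_left)
qed (simp add: b)

text \<open>The common form of the straight-line homotopies below. A common face is demanded only
  where \<open>u\<close> is positive, so a homotopy may stand still at points that share no face
  with its target.\<close>

lemma continuous_map_convex_combination:
  assumes f: "continuous_map X (realization K) f" and g: "continuous_map X (realization K) g"
    and u: "continuous_map X euclideanreal u" "\<And>p. p \<in> topspace X \<Longrightarrow> 0 \<le> u p \<and> u p \<le> 1"
    and K: "\<And>p. \<lbrakk>p \<in> topspace X; 0 < u p\<rbrakk> \<Longrightarrow> support (f p) \<union> support (g p) \<in> K"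
  shows "continuous_map X (realization K) (\<lambda>p i. (1 - u p) * f p i + u p * g p i)"
  unfolding continuous_map_realization_iff
proof (intro conjI allI ballI)
  fix i
  show "continuous_map X euclideanreal (\<lambda>p. (1 - u p) * f p i + u p * g p i)"
    by (intro continuous_intros u(1) continuous_map_realization_coordinate2[OF f] continuous_map_realization_coordinate2[OF g]) auto
next
  fix p assume p: "p \<in> topspace X"
  then show "(\<lambda>i. (1 - u p) * f p i + u p * g p i) \<in> topspace (realization K)"
    using f g u(2) K by (intro convex_combination_in_realization) (auto simp: continuous_map_def Pi_iff)
qed

text \<open>The realization is cut out of a compact cube by closed conditions: total weight 1, and
  vanishing outside one of the finitely many faces.\<close>

lemma compact_space_realization: "compact_space (realization K)"
proof -
  let ?P = "powertop_real (UNIV :: 'a set)"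
  let ?B = "PiE UNIV (\<lambda>x::'a. {0..1::real})"
  have finK: "finite K"
    using finite_vertices faces by (meson finite_Pow_iff finite_subset)
  have eq: "topspace (realization K) = ?B \<inter> ({b. sum b V = 1} \<inter> (\<Union>F\<in>K. \<Inter>x\<in>-F. {b. b x = 0}))"
  proof (intro equalityI subsetI)
    fix b assume b: "b \<in> topspace (realization K)"
    then show "b \<in> ?B \<inter> ({b. sum b V = 1} \<inter> (\<Union>F\<in>K. \<Inter>x\<in>-F. {b. b x = 0}))"
      using realization_le_1[OF b] by (force simp: mem_realization)
  next
    fix b assume b: "b \<in> ?B \<inter> ({b. sum b V = 1} \<inter> (\<Union>F\<in>K. \<Inter>x\<in>-F. {b. b x = 0}))"
    then obtain F where "F \<in> K" "support b \<subseteq> F"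
      by auto
    then have "support b \<in> K"
      using face_subset by blast
    with b show "b \<in> topspace (realization K)"
      by (auto simp: mem_realization PiE_iff)
  qed
  have coord: "continuous_map ?P euclideanreal (\<lambda>b. b x)" for x
    using continuous_map_product_projection[of x UNIV "\<lambda>_. euclideanreal"] by simp
  have "closedin ?P {b \<in> topspace ?P. sum b V \<in> {1}}"
    by (rule closedin_continuous_map_preimage[of _ euclideanreal])
      (auto intro!: continuous_intros coord finite_vertices)
  then have c1: "closedin ?P {b. sum b V = 1}"
    by simp
  have "closedin ?P {b \<in> topspace ?P. b x \<in> {0}}" for x
    by (rule closedin_continuous_map_preimage[OF coord]) auto
  then have c2: "closedin ?P {b. b x = 0}" for x
    by simp
  have c3: "closedin ?P (\<Union>F\<in>K. \<Inter>x\<in>-F. {b. b x = 0})"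
  proof (intro closedin_Union)
    fix S assume "S \<in> (\<lambda>F. \<Inter>x\<in>-F. {b. b x = (0::real)}) ` K"
    then obtain F where F: "F \<in> K" "S = (\<Inter>x\<in>-F. {b. b x = 0})"
      by blast
    \<comment> \<open>If \<open>F\<close> exhausts the type, the intersection is over an empty
      family and is the whole space.\<close>
    show "closedin ?P S"
    proof (cases "F = UNIV")
      case False
      then show ?thesis
        unfolding F(2) by (intro closedin_Inter) (auto simp: c2)
    qed (use F closedin_topspace[of ?P] in simp)
  qed (use finK in auto)
  have "compactin ?P ?B"
    by (subst compactin_PiE) auto
  then have "compactin ?P (topspace (realization K))"
    unfolding eq by (intro compact_Int_closedin closedin_Int c1 c3)
  then show ?thesis
    using compact_space_subtopology[of ?P "topspace (realization K)"]
    by (simp add: realization_def)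
qed

text \<open>The smallest ratio of coordinates over the face carrying \<open>x\<close> is positive
  exactly on the open star of that face, and there the segment to \<open>x\<close> stays in the face
  carrying the moving point. \<open>E\<close> covers the fraction \<open>u\<close> of this segment:
  none of it off the star, all of it as soon as \<open>2 * t * m a\<close> reaches 1.\<close>

lemma well_pointed_realization:
  assumes x: "x \<in> topspace (realization K)"
  shows "well_pointed (realization K) x"
proof -
  let ?X = "realization K"
  let ?S = "support x"
  have S: "finite ?S" "?S \<noteq> {}"
    using x support_nonempty[OF x] by (auto simp: topspace_realization)
  define m where "m b = min 1 (INF i\<in>?S. b i / x i)" for b
  have xpos: "0 < x i" if "i \<in> ?S" for i
    using x that by (auto simp: mem_realization less_le)
  have m0: "0 \<le> m b" if "b \<in> topspace ?X" for b
    using that S(2) realization_nonneg[OF that] realization_nonneg[OF x]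
    by (auto simp: m_def intro!: cINF_greatest)
  have mcont: "continuous_map ?X euclideanreal m"
    unfolding m_def using S by (intro continuous_intros continuous_map_Inf) auto
  have mx: "m x = 1"
  proof -
    have "(\<lambda>i. x i / x i) ` ?S = {1}"
      using S by auto
    then show ?thesis
      by (simp add: m_def)
  qed
  have mpos: "?S \<subseteq> support b" if "b \<in> topspace ?X" "0 < m b" for b
  proof
    fix i assume i: "i \<in> ?S"
    have "(INF i\<in>?S. b i / x i) \<le> b i / x i"
      using i S by (intro cINF_lower) auto
    then have "0 < b i / x i"
      using that(2) by (auto simp: m_def)
    then show "i \<in> support b"
      by auto
  qed
  define u where "u p = min 1 (2 * fst p * m (snd p))" for p :: "real \<times> ('a \<Rightarrow> real)"
  define E where "E = (\<lambda>p i. (1 - u p) * snd p i + u p * x i)"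
  let ?I = "prod_topology unit_interval ?X"
  have E: "continuous_map ?I ?X E"
    unfolding E_def
  proof (rule continuous_map_convex_combination)
    show "continuous_map ?I ?X (\<lambda>p. x)"
      using x by simp
    show "continuous_map ?I euclideanreal u"
      unfolding u_def
      by (intro continuous_intros continuous_map_real_fst continuous_map_compose2[OF mcont] continuous_map_snd) auto
    fix p assume p: "p \<in> topspace ?I"
    then show "0 \<le> u p \<and> u p \<le> 1"
      using m0[of "snd p"] by (auto simp: u_def)
    assume "0 < u p"
    then have "0 < m (snd p)"
      using p m0[of "snd p"] by (auto simp: u_def zero_less_mult_iff)
    then have "?S \<subseteq> support (snd p)"
      using p by (intro mpos) auto
    then have "support (snd p) \<union> ?S = support (snd p)"
      by auto
    then show "support (snd p) \<union> ?S \<in> K"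
      using p support_in_complex by fastforce
  qed (rule continuous_map_snd)
  show ?thesis
    unfolding well_pointed_def
  proof (intro conjI x exI[of _ m] exI[of _ E] mcont mx E ballI impI)
    show "m a \<le> 1" for a
      by (simp add: m_def)
    show "E (0, a) = a" for a
      using m0 by (simp add: E_def u_def)
    show "E (t, x) = x" for t
      by (auto simp: E_def algebra_simps)
    show "E (t, a) = x" if "1 \<le> 2 * t * m a" for t a
      using that by (simp add: E_def u_def)
  qed
qed

lemma path_component_of_realization:
  assumes b: "b \<in> topspace (realization K)" and c: "c \<in> topspace (realization K)" and K: "support b \<union> support c \<in> K"
  shows "path_component_of (realization K) b c"
  unfolding path_component_of_def pathin_def
proof (intro exI[of _ "\<lambda>t i. (1 - t) * b i + t * c i"] conjI)
  show "continuous_map unit_interval (realization K) (\<lambda>t i. (1 - t) * b i + t * c i)"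
    by (rule continuous_map_convex_combination) (use assms in auto)
qed auto

text \<open>A point is joined to a vertex of its own support, and that vertex to \<open>w\<close>
  along an edge.\<close>

lemma path_connected_space_realization:
  assumes w: "\<And>x. {x} \<in> K \<Longrightarrow> {x, w} \<in> K"
  shows "path_connected_space (realization K)"
proof -
  have "path_component_of (realization K) b (vertex w)" if b: "b \<in> topspace (realization K)" for b
  proof -
    obtain x where x: "x \<in> support b"
      using support_nonempty[OF b] by blast
    have sb: "support b \<in> K" and sx: "{x} \<in> K"
      using b x support_in_complex[OF b] face_subset[of "support b" "{x}"] by auto
    then have xw: "{x, w} \<in> K" and sw: "{w} \<in> K"
      using w[of x] face_subset[of "{x, w}" "{w}"] by auto
    have sup: "support (vertex y) = {y}" for y :: 'a
      by (auto simp: vertex_def)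
    have "support b \<union> {x} = support b" "{x} \<union> {w} = {x, w}"
      using x by auto
    then have "path_component_of (realization K) b (vertex x)" "path_component_of (realization K) (vertex x) (vertex w)"
      using sb sx xw sw b by (auto intro!: path_component_of_realization vertex_in_realization simp: sup)
    then show ?thesis
      by (rule path_component_of_trans)
  qed
  then show ?thesis
    unfolding path_connected_space_iff_path_component
    by (meson path_component_of_sym path_component_of_trans)
qed

end

section \<open>Coning off a subcomplex\<close>

text \<open>Requiring \<open>L\<close> to be nonempty excludes only the void complex.
  \<open>L\<close> then has the empty face, so the apex is a vertex of the cone, while the
  realization of \<open>L\<close> may still be empty.\<close>

locale coned_subcomplex = finite_complex V K for V :: "'a set" and K +
  fixes L :: "'a set set" and v :: 'a
  assumes subcomplex: "L \<subseteq> K" and subcomplex_subset: "\<And>F F'. \<lbrakk>F \<in> L; F' \<subseteq> F\<rbrakk> \<Longrightarrow> F' \<in> L"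
    and subcomplex_nonempty: "L \<noteq> {}" and apex: "v \<notin> V"
begin

abbreviation "coned \<equiv> K \<union> insert v ` L"
abbreviation "subcone \<equiv> L \<union> insert v ` L"

lemma finite_complex_L: "finite_complex V L"
  using finite_vertices faces subcomplex subcomplex_subset by unfold_locales auto

lemma finite_complex_total: "finite_complex (insert v V) coned"
proof
  fix F F' assume F: "F \<in> coned" "F' \<subseteq> F"
  show "F' \<in> coned"
  proof (cases "F \<in> K")
    case False
    then obtain F0 where F0: "F0 \<in> L" "F = insert v F0"
      using F by blast
    then have "F' - {v} \<in> L"
      using F(2) subcomplex_subset[of F0 "F' - {v}"] by blast
    then show ?thesis
      using subcomplex by (cases "v \<in> F'") (auto simp: image_iff insert_absorb intro!: bexI[of _ "F' - {v}"])
  qed (use F face_subset in blast)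
qed (use finite_vertices faces subcomplex in auto)

lemma finite_complex_cone: "finite_complex (insert v V) subcone"
proof
  fix F F' assume F: "F \<in> subcone" "F' \<subseteq> F"
  then obtain F0 where F0: "F0 \<in> L" "F \<subseteq> insert v F0"
    by blast
  then have "F' - {v} \<in> L"
    using F(2) subcomplex_subset[of F0 "F' - {v}"] by blast
  then show "F' \<in> subcone"
    by (cases "v \<in> F'") (auto simp: image_iff insert_absorb intro!: bexI[of _ "F' - {v}"])
qed (use finite_vertices faces subcomplex in auto)

sublocale L: finite_complex V L by (rule finite_complex_L)
sublocale M: finite_complex "insert v V" coned by (rule finite_complex_total)
sublocale A: finite_complex "insert v V" subcone by (rule finite_complex_cone)

abbreviation "RK \<equiv> realization K"
abbreviation "RL \<equiv> realization L"
abbreviation "RM \<equiv> realization coned"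
abbreviation "RA \<equiv> realization subcone"

lemma not_apex: "F \<in> K \<Longrightarrow> v \<notin> F"
  using apex faces by blast

lemma realization_subset: "topspace RK \<subseteq> topspace RM" "topspace RA \<subseteq> topspace RM" "topspace RL \<subseteq> topspace RK"
  using subcomplex by (auto intro!: topspace_realization_mono)

lemma realization_eq: "RK = subtopology RM (topspace RK)" "RA = subtopology RM (topspace RA)"
  "RL = subtopology RK (topspace RL)"
  using subcomplex by (auto intro!: realization_subcomplex)

lemma closedin_realization: "closedin RM (topspace RK)" "closedin RM (topspace RA)"
proof -
  have "compactin (subtopology RM (topspace RK)) (topspace RK)"
    using compact_space_realization by (subst realization_eq(1)[symmetric]) (simp add: compact_space_def)
  then have "compactin RM (topspace RK)"
    by (simp add: compactin_subtopology)
  then show "closedin RM (topspace RK)"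
    using Hausdorff_space_realization compactin_imp_closedin by blast
  have "compactin (subtopology RM (topspace RA)) (topspace RA)"
    using A.compact_space_realization by (subst realization_eq(2)[symmetric]) (simp add: compact_space_def)
  then have "compactin RM (topspace RA)"
    by (simp add: compactin_subtopology)
  then show "closedin RM (topspace RA)"
    using Hausdorff_space_realization compactin_imp_closedin by blast
qed

lemma realization_Un: "topspace RK \<union> topspace RA = topspace RM"
  using subcomplex by (auto simp: topspace_realization)

lemma realization_Int: "topspace RK \<inter> topspace RA = topspace RL"
  using subcomplex by (auto simp: topspace_realization dest: not_apex)

lemma apex_in_cone: "vertex v \<in> topspace RA"
proof -
  have "{} \<in> L"
    using subcomplex_nonempty subcomplex_subset by blast
  then show ?thesis
    by (intro A.vertex_in_realization) auto
qed

lemma apex_coordinate_0: "b \<in> topspace RK \<Longrightarrow> b v = 0"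
  using not_apex support_in_complex by fastforce

lemma apex_coordinate_pos: "\<lbrakk>b \<in> topspace RM; b v \<noteq> 0\<rbrakk> \<Longrightarrow> support b - {v} \<in> L"
proof -
  assume b: "b \<in> topspace RM" "b v \<noteq> 0"
  then obtain F where F: "F \<in> L" "support b = insert v F"
    using support_in_complex[OF b(1)] not_apex by blast
  then have "v \<notin> F"
    using not_apex subcomplex by blast
  with F show ?thesis by simp
qed

lemma support_cone:
  assumes b: "b \<in> topspace RA"
  shows "support b - {v} \<in> L"
proof -
  obtain F where "F \<in> L" "support b - {v} \<subseteq> F"
    using support_in_complex[OF b] by blast
  then show ?thesis
    by (rule subcomplex_subset)
qed

lemma finite_L: "finite L"
  by (meson finite_Pow_iff finite_subset finite_vertices L.faces)

text \<open>\<open>weight_outside b\<close> vanishes exactly on the cone, and discarding all coordinates that do not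
  exceed it moves \<open>b\<close> into the subcomplex. Hence in \<open>pushed t b\<close> the coordinates in \<open>V\<close> are
  truncated at the level \<open>\<tau>\<close>, and the apex gets positive weight only once \<open>\<tau>\<close> exceeds
  \<open>weight_outside b\<close>.\<close>

definition weight_outside :: "('a \<Rightarrow> real) \<Rightarrow> real" where
  "weight_outside b = (INF F\<in>L. \<Sum>x\<in>V - F. b x)"

definition max_weight :: "('a \<Rightarrow> real) \<Rightarrow> real" where
  "max_weight b = (SUP x\<in>insert v V. b x)"

definition truncation :: "real \<Rightarrow> ('a \<Rightarrow> real) \<Rightarrow> real" where
  "truncation t b = t * max 0 (max_weight b - weight_outside b)"

definition pushed :: "real \<Rightarrow> ('a \<Rightarrow> real) \<Rightarrow> 'a \<Rightarrow> real" where
  "pushed t b x =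
     (if x = v then b v + max 0 (truncation t b - weight_outside b)
      else if x \<in> V then max 0 (b x - truncation t b) else 0)"

definition push :: "real \<times> ('a \<Rightarrow> real) \<Rightarrow> 'a \<Rightarrow> real" where
  "push = (\<lambda>(t, b) x. pushed t b x / sum (pushed t b) (insert v V))"

lemma weight_outside_nonneg: "b \<in> topspace RM \<Longrightarrow> 0 \<le> weight_outside b"
  unfolding weight_outside_def using subcomplex_nonempty realization_nonneg[of b]
  by (intro cINF_greatest sum_nonneg) auto

lemma weight_outside_attained: obtains F where "F \<in> L" "weight_outside b = (\<Sum>x\<in>V - F. b x)"
proof -
  have "weight_outside b = Min ((\<lambda>F. \<Sum>x\<in>V - F. b x) ` L)"
    unfolding weight_outside_def using finite_L subcomplex_nonempty by (intro cInf_eq_Min) auto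
  also have "\<dots> \<in> (\<lambda>F. \<Sum>x\<in>V - F. b x) ` L"
    using finite_L subcomplex_nonempty by (intro Min_in) auto
  finally show thesis
    using that by blast
qed

lemma weight_outside_cone: "b \<in> topspace RA \<Longrightarrow> weight_outside b = 0"
proof (rule antisym)
  assume b: "b \<in> topspace RA"
  let ?F = "support b - {v}"
  have "weight_outside b \<le> (\<Sum>x\<in>V - ?F. b x)"
    unfolding weight_outside_def using finite_L support_cone[OF b] by (intro cINF_lower) auto
  also have "\<dots> = 0"
    using apex by (intro sum.neutral) auto
  finally show "weight_outside b \<le> 0" .
  show "0 \<le> weight_outside b"
    using b realization_subset by (intro weight_outside_nonneg) auto
qed

lemma le_max_weight: "x \<in> insert v V \<Longrightarrow> b x \<le> max_weight b"
  unfolding max_weight_def using finite_vertices by (intro cSUP_upper) auto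

lemma max_weight_pos: "b \<in> topspace RM \<Longrightarrow> 0 < max_weight b"
proof -
  assume b: "b \<in> topspace RM"
  obtain x where x: "x \<in> support b"
    using support_nonempty[OF b] by blast
  then have "0 < b x" "x \<in> insert v V"
    using realization_nonneg[OF b, of x] support_in_complex[OF b] M.faces by auto
  then show ?thesis
    using le_max_weight[of x b] by linarith
qed

lemma max_weight_le: "\<lbrakk>\<And>x. x \<in> insert v V \<Longrightarrow> b x \<le> d\<rbrakk> \<Longrightarrow> max_weight b \<le> d"
  unfolding max_weight_def by (intro cSUP_least) auto

lemma truncation_nonneg: "0 \<le> t \<Longrightarrow> 0 \<le> truncation t b"
  by (simp add: truncation_def)

lemma pushed_nonneg: "b \<in> topspace RM \<Longrightarrow> 0 \<le> pushed t b x"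
  using realization_nonneg[of b] by (simp add: pushed_def)

text \<open>If all weights vanished, the level would be at least the largest coordinate. As it is at
  most \<open>max_weight b - weight_outside b\<close>, the outside weight would be 0, below the
  level, and the apex would have positive weight after all. This is why \<open>truncation\<close>
  subtracts \<open>weight_outside\<close>.\<close>

lemma pushed_sum_pos:
  assumes b: "b \<in> topspace RM" and t: "t \<in> {0..1}"
  shows "0 < sum (pushed t b) (insert v V)"
proof (rule ccontr)
  let ?\<tau> = "truncation t b" and ?c = "weight_outside b" and ?d = "max_weight b"
  assume "\<not> ?thesis"
  then have "sum (pushed t b) (insert v V) = 0"
    using sum_nonneg[of "insert v V" "pushed t b"] pushed_nonneg[OF b] by force
  then have 0: "pushed t b x = 0" if "x \<in> insert v V" for x
    using sum_nonneg_eq_0_iff[of "insert v V" "pushed t b"] pushed_nonneg[OF b] finite_vertices that by auto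
  have "b v = 0" "?\<tau> \<le> ?c"
    using 0[of v] realization_nonneg[OF b, of v] by (auto simp: pushed_def max_def split: if_splits)
  moreover have "b x \<le> ?\<tau>" if "x \<in> V" for x
  proof -
    have "x \<noteq> v"
      using that apex by blast
    then show ?thesis
      using 0[of x] that by (simp add: pushed_def)
  qed
  ultimately have "?d \<le> ?\<tau>"
    using truncation_nonneg[of t b] t by (intro max_weight_le) auto
  moreover have "?\<tau> \<le> max 0 (?d - ?c)"
    using t unfolding truncation_def by (intro mult_left_le_one_le) auto
  ultimately show False
    using max_weight_pos[OF b] weight_outside_nonneg[OF b] \<open>?\<tau> \<le> ?c\<close> by (auto simp: max_def split: if_splits)
qed

lemma support_pushed_subset:
  assumes b: "b \<in> topspace RM" and t: "t \<in> {0..1}"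
  shows "support (pushed t b) - {v} \<subseteq> support b"
  using truncation_nonneg[of t b] t by (auto simp: pushed_def max_def split: if_splits)

text \<open>If the apex had weight from the start, the point was in the cone. Otherwise the level
  exceeds \<open>weight_outside b\<close>; for a face \<open>F\<close> attaining this infimum, each
  coordinate outside \<open>F\<close> is at most the infimum and has been truncated.\<close>

lemma support_pushed_apex:
  assumes b: "b \<in> topspace RM" and t: "t \<in> {0..1}" and v: "pushed t b v \<noteq> 0"
  shows "support (pushed t b) - {v} \<in> L"
proof (cases "b v = 0")
  case False
  then show ?thesis
    using support_pushed_subset[OF b t] by (intro subcomplex_subset[OF apex_coordinate_pos[OF b]]) blast+
next
  case True
  then have less: "weight_outside b < truncation t b"
    using v by (auto simp: pushed_def max_def split: if_splits)
  obtain F where F: "F \<in> L" "weight_outside b = (\<Sum>x\<in>V - F. b x)"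
    by (rule weight_outside_attained)
  have "support (pushed t b) - {v} \<subseteq> F"
  proof
    fix x assume x: "x \<in> support (pushed t b) - {v}"
    then have "x \<in> V" "truncation t b < b x"
      by (auto simp: pushed_def split: if_splits)
    moreover have "b x \<le> weight_outside b" if "x \<in> V - F"
      unfolding F(2) using that finite_vertices realization_nonneg[OF b] by (intro member_le_sum) auto
    ultimately show "x \<in> F"
      using less by force
  qed
  then show ?thesis
    using F(1) subcomplex_subset by blast
qed

lemma support_push:
  assumes b: "b \<in> topspace RM" and t: "t \<in> {0..1}"
  shows "support (push (t, b)) = support (pushed t b)"
  using pushed_sum_pos[OF assms] by (simp add: push_def)

text \<open>With the apex present, the rest of the support is in \<open>L\<close>; with the apex
  absent, the support has only shrunk.\<close>

lemma support_pushed: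
  assumes b: "b \<in> topspace RM" and t: "t \<in> {0..1}"
  shows "support (pushed t b) \<in> coned" "b \<in> topspace RA \<Longrightarrow> support (pushed t b) \<in> subcone"
proof -
  have "support (pushed t b) \<in> insert v ` L" if "pushed t b v \<noteq> 0"
    using support_pushed_apex[OF assms that] that by (force simp: image_iff intro!: bexI[of _ "support (pushed t b) - {v}"])
  moreover have "support (pushed t b) \<subseteq> support b - {v}" if "pushed t b v = 0"
    using support_pushed_subset[OF assms] that by blast
  moreover have "support b - {v} \<in> K"
    using support_in_complex[OF b] face_subset subcomplex subcomplex_subset apex_coordinate_pos[OF b]
    by (cases "b v = 0") (auto dest: not_apex)
  ultimately show "support (pushed t b) \<in> coned" "b \<in> topspace RA \<Longrightarrow> support (pushed t b) \<in> subcone"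
    using face_subset subcomplex_subset support_cone by blast+
qed

lemma push_in_realization:
  assumes b: "b \<in> topspace RM" and t: "t \<in> {0..1}"
  shows "push (t, b) \<in> topspace RM" "b \<in> topspace RA \<Longrightarrow> push (t, b) \<in> topspace RA"
proof -
  show 1: "push (t, b) \<in> topspace RM"
    using M.normalise_in_realization[of "pushed t b"] pushed_nonneg[OF b] support_pushed(1)[OF assms] pushed_sum_pos[OF assms]
    by (simp add: push_def del: Un_iff)
  show "push (t, b) \<in> topspace RA" if "b \<in> topspace RA"
    using support_pushed(2)[OF assms that] unfolding topspace_realization_subset_iff[OF 1] support_push[OF assms] .
qed

lemma push_0: "b \<in> topspace RM \<Longrightarrow> push (0, b) = b"
proof -
  assume b: "b \<in> topspace RM"
  have "b x = 0" if "x \<notin> insert v V" for x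
    using support_in_complex[OF b] M.faces that by blast
  then have "pushed 0 b = b"
    using weight_outside_nonneg[OF b] realization_nonneg[OF b] by (auto simp: pushed_def truncation_def)
  then show ?thesis
    using b by (simp add: push_def M.mem_realization del: Un_iff)
qed

text \<open>On the cone nothing lies outside \<open>L\<close>, so at time 1 the level is the largest
  coordinate and everything but the apex is truncated.\<close>

lemma push_1_cone: "b \<in> topspace RA \<Longrightarrow> push (1, b) = vertex v"
proof -
  assume b: "b \<in> topspace RA"
  then have bM: "b \<in> topspace RM"
    using realization_subset by blast
  have "truncation 1 b = max_weight b"
    using weight_outside_cone[OF b] max_weight_pos[OF bM] by (simp add: truncation_def)
  then have 0: "pushed 1 b x = 0" if "x \<noteq> v" for x
    using that le_max_weight[of x b] by (simp add: pushed_def)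
  have "sum (pushed 1 b) V = 0"
    using 0 apex by (intro sum.neutral) metis
  then have "sum (pushed 1 b) (insert v V) = pushed 1 b v"
    using finite_vertices apex by simp
  with 0 show ?thesis
    using pushed_sum_pos[OF bM, of 1] by (auto simp: push_def vertex_def)
qed

lemma continuous_map_push: "continuous_map (prod_topology unit_interval RM) RM push"
proof -
  let ?I = "prod_topology unit_interval RM"
  have coord: "continuous_map ?I euclideanreal (\<lambda>p. snd p x)" for x
    by (rule continuous_map_realization_coordinate2[OF continuous_map_snd])
  have c: "continuous_map ?I euclideanreal (\<lambda>p. weight_outside (snd p))"
    unfolding weight_outside_def
    by (intro continuous_map_Inf continuous_map_sum coord finite_L) (use finite_vertices in auto)
  have d: "continuous_map ?I euclideanreal (\<lambda>p. max_weight (snd p))"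
    unfolding max_weight_def
    by (intro continuous_map_Sup coord) (use finite_vertices in auto)
  have \<tau>: "continuous_map ?I euclideanreal (\<lambda>p. truncation (fst p) (snd p))"
    unfolding truncation_def by (intro continuous_intros c d continuous_map_real_fst) auto
  have w: "continuous_map ?I euclideanreal (\<lambda>p. pushed (fst p) (snd p) x)" for x
    unfolding pushed_def by (cases "x = v"; cases "x \<in> V") (auto intro!: continuous_intros c \<tau> coord)
  have "continuous_map ?I euclideanreal (\<lambda>p. pushed (fst p) (snd p) x / sum (pushed (fst p) (snd p)) (insert v V))" for x
  proof (intro continuous_map_real_divide continuous_map_sum w)
    fix p assume "p \<in> topspace ?I"
    then show "sum (pushed (fst p) (snd p)) (insert v V) \<noteq> 0"
      using pushed_sum_pos[of "snd p" "fst p"] by auto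
  qed (use finite_vertices in simp)
  moreover have "push p \<in> topspace RM" if "p \<in> topspace ?I" for p
    using that push_in_realization(1)[of "snd p" "fst p"] by auto
  ultimately show ?thesis
    unfolding continuous_map_realization_iff by (simp add: push_def case_prod_unfold)
qed

theorem homotopy_equivalent_quotient: "RM homotopy_equivalent_space collapse RK (topspace RL)"
proof -
  have "RM homotopy_equivalent_space collapse (subtopology RM (topspace RK)) (topspace RK \<inter> topspace RA)"
  proof (rule homotopy_equivalent_collapse[OF closedin_realization realization_Un continuous_map_push push_0])
    show "push (t, b) \<in> topspace RA" if "t \<in> {0..1}" "b \<in> topspace RA" for t b
      using that realization_subset push_in_realization(2) by blast
    show "push (1, b) = vertex v" if "b \<in> topspace RA" for b
      using that by (rule push_1_cone)
  qed (auto intro: apex_in_cone)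
  then show ?thesis
    unfolding realization_Int realization_eq(1)[symmetric] .
qed

end

section \<open>The coned complex as the mapping cone of the inclusion of \<open>L\<close> into
  \<open>K\<close>\<close>

context coned_subcomplex
begin

definition cone_point :: "('a \<Rightarrow> real) \<times> real \<Rightarrow> 'a \<Rightarrow> real" where
  "cone_point = (\<lambda>p i. (1 - snd p) * fst p i + snd p * vertex v i)"

lemma cone_point_apex: "l \<in> topspace RL \<Longrightarrow> cone_point (l, s) v = s"
  using apex_coordinate_0 realization_subset(3) by (auto simp: cone_point_def vertex_def)

lemma continuous_map_cone_point: "continuous_map (prod_topology RL unit_interval) RM cone_point"
  unfolding cone_point_def
proof (rule M.continuous_map_convex_combination)
  let ?X = "prod_topology RL unit_interval"
  have RLM: "topspace RL \<subseteq> topspace RM"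
    using realization_subset by blast
  then show "continuous_map ?X RM (\<lambda>p. fst p)"
    using continuous_map_fst[of RL unit_interval] by (auto simp: continuous_map_realization_iff)
  show "continuous_map ?X RM (\<lambda>p. vertex v)"
    using apex_in_cone realization_subset by (simp add: subset_iff)
  show "continuous_map ?X euclideanreal (\<lambda>p. snd p)"
    using continuous_map_snd continuous_map_into_fulltopology by blast
  fix p assume p: "p \<in> topspace ?X"
  then show "0 \<le> snd p \<and> snd p \<le> 1"
    by auto
  have "support (fst p) \<union> support (vertex v) = insert v (support (fst p))"
    by (auto simp: vertex_def)
  moreover have "support (fst p) \<in> L"
    using p support_in_complex[of "fst p" L] by auto
  ultimately show "support (fst p) \<union> support (vertex v) \<in> coned"
    by simp
qed

text \<open>The apex coordinate decides: 0 means a point of \<open>K\<close>, 1 the apex. In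
  between, deleting that coordinate and dividing by \<open>1 - b v\<close> finds the point of
  \<open>L\<close> at the foot of the cone segment.\<close>

lemma coned_cases:
  assumes b: "b \<in> topspace RM"
  obtains "b \<in> topspace RK" | "b = vertex v" | l where "l \<in> topspace RL" "0 < b v" "b v < 1" "b = cone_point (l, b v)"
proof -
  have V: "(\<Sum>i\<in>V. b i) = 1 - b v"
    using b finite_vertices apex by (simp add: M.mem_realization del: Un_iff)
  have out: "b i = 0" if "i \<notin> insert v V" for i
    using support_in_complex[OF b] M.faces that by blast
  consider "b v = 0" | "b v = 1" | "0 < b v" "b v < 1"
    using realization_nonneg[OF b, of v] M.realization_le_1[OF b, of v] by linarith
  then show thesis
  proof cases
    case 1
    then have "support b \<in> K"
      using support_in_complex[OF b] by auto
    then show thesis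
      using that(1) topspace_realization_subset_iff[OF b] by blast
  next
    case 2
    then have "b i = 0" if "i \<in> V" for i
      using V sum_nonneg_eq_0_iff[of V b] finite_vertices realization_nonneg[OF b] that by simp
    then have "b i = vertex v i" for i
      using out[of i] 2 by (auto simp: vertex_def)
    then show thesis
      using that(2) by blast
  next
    case 3
    define w where "w i = (if i = v then 0 else b i)" for i
    have sw: "sum w V = 1 - b v"
      using V apex by (metis (mono_tags, lifting) sum.cong w_def)
    have "support w = support b - {v}"
      by (auto simp: w_def)
    then have "support w \<in> L"
      using apex_coordinate_pos[OF b] 3 by auto
    then have "(\<lambda>i. w i / sum w V) \<in> topspace RL"
      using realization_nonneg[OF b] sw 3 by (intro L.normalise_in_realization) (auto simp: w_def)
    moreover have "b = cone_point (\<lambda>i. w i / sum w V, b v)"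
    proof
      fix i
      show "b i = cone_point (\<lambda>i. w i / sum w V, b v) i"
        unfolding sw using 3 by (simp add: cone_point_def w_def vertex_def)
    qed
    ultimately show thesis
      using that(3) 3 by blast
  qed
qed

text \<open>A continuous surjection from a compact space onto a Hausdorff space is closed, hence a
  quotient map. The apex coordinate equals the cone parameter, which yields injectivity on the open
  cone and separates it from base and apex.\<close>

lemma mapping_cone_coned:
  "mapping_cone RL RK id RM id cone_point (vertex v)"
proof -
  let ?D = "disjoint_union RK (disjoint_union (prod_topology RL unit_interval) (discrete_topology {()}))"
  let ?q = "case_sum id (case_sum cone_point (\<lambda>_. vertex v))"
  have vM: "vertex v \<in> topspace RM"
    using apex_in_cone realization_subset by blast
  have "continuous_map RK RM id"
    using realization_eq(1) continuous_map_id_subt by metis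
  then have q: "continuous_map ?D RM ?q"
    using continuous_map_cone_point vM
    by (intro continuous_map_from_disjoint_union) (simp_all add: o_def id_def)
  have "?q ` topspace ?D = topspace RM"
  proof
    show "?q ` topspace ?D \<subseteq> topspace RM"
      using continuous_map_image_subset_topspace[OF q] .
    show "topspace RM \<subseteq> ?q ` topspace ?D"
    proof
      fix b assume "b \<in> topspace RM"
      then show "b \<in> ?q ` topspace ?D"
      proof (cases rule: coned_cases)
        case 1
        then show ?thesis
          by (intro image_eqI[of _ _ "Inl b"]) auto
      next
        case 2
        then show ?thesis
          by (intro image_eqI[of _ _ "Inr (Inr ())"]) auto
      next
        case (3 l)
        then show ?thesis
          by (intro image_eqI[of _ _ "Inr (Inl (l, b v))"]) auto
      qed
    qed
  qed
  moreover have "compact_space ?D"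
    using compact_space_realization L.compact_space_realization
    by (intro compact_space_disjoint_union) (auto simp: compact_space_prod_topology compact_space_subtopology compact_space_discrete_topology)
  ultimately have quot: "quotient_map ?D RM ?q"
    using q continuous_imp_closed_map[OF q _ Hausdorff_space_realization] by (intro continuous_closed_imp_quotient_map) auto
  have inj: "inj_on cone_point (topspace RL \<times> {0<..<1})"
  proof (rule inj_onI, clarify)
    fix l s l' s' assume l: "l \<in> topspace RL" "l' \<in> topspace RL" and s: "s \<in> {0<..<1::real}" "s' \<in> {0<..<1::real}"
      and eq: "cone_point (l, s) = cone_point (l', s')"
    have "s = s'"
      using fun_cong[OF eq, of v] unfolding cone_point_apex[OF l(1)] cone_point_apex[OF l(2)] .
    moreover have "l i = l' i" for i
      using fun_cong[OF eq, of i] s unfolding \<open>s = s'\<close> by (simp add: cone_point_def)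
    ultimately show "l = l' \<and> s = s'"
      by blast
  qed
  have notin: "cone_point p \<notin> topspace RK" "cone_point p \<noteq> vertex v" if p: "p \<in> topspace RL \<times> {0<..<1}" for p
  proof -
    have "cone_point p v = snd p" "0 < snd p" "snd p < 1"
      using p cone_point_apex[of "fst p" "snd p"] by auto
    moreover have "vertex v v = 1"
      by (simp add: vertex_def)
    ultimately have "cone_point p v \<noteq> 0" "cone_point p v \<noteq> vertex v v"
      by linarith+
    then show "cone_point p \<notin> topspace RK" "cone_point p \<noteq> vertex v"
      using apex_coordinate_0[of "cone_point p"] by auto
  qed
  have disj: "cone_point ` (topspace RL \<times> {0<..<1}) \<inter> id ` topspace RK = {}"
    unfolding image_id
    using notin(1) by (intro equals0I) (elim IntE imageE, simp)
  have 1: "vertex v \<notin> cone_point ` (topspace RL \<times> {0<..<1})"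
    using notin(2) by (intro notI) (elim imageE, metis)
  have 2: "vertex v \<notin> id ` topspace RK"
    using apex_coordinate_0[of "vertex v"] by (auto simp: vertex_def)
  have ends: "cone_point (l, 0) = id (id l)" "cone_point (l, 1) = vertex v" for l
    by (simp_all add: cone_point_def)
  show ?thesis
    unfolding mapping_cone_def by (intro conjI ballI quot ends inj_on_id inj disj 1 2)
qed

text \<open>Over an empty \<open>RL\<close> the suspension consists of its poles, and
  \<open>p\<close> is chosen as the pole that is \<open>y\<close>. Otherwise the wedge is formed at
  the pole with parameter 0 and its base point is then moved to \<open>y\<close>.\<close>

theorem homotopy_equivalent_wedge:
  assumes hom: "homotopic_with (\<lambda>_. True) RL RK id (\<lambda>_. x)" and x: "x \<in> topspace RK"
    and y: "y \<in> topspace (suspension RL)"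
  shows "RM homotopy_equivalent_space wedge RK x (suspension RL) y"
proof -
  have *: "RM homotopy_equivalent_space wedge RK x (suspension RL) (Inr p)" if "\<not> p \<or> topspace RL = {}" for p
    by (rule mapping_cone_homotopy_equivalent[OF mapping_cone_coned mapping_cone_wedge_suspension[OF x that] hom])
  show ?thesis
  proof (cases "topspace RL = {}")
    case True
    then obtain p where "y = Inr p"
      using y unfolding topspace_suspension_image by auto
    then show ?thesis
      using * True by blast
  next
    case False
    then obtain l where "l \<in> topspace RL"
      by blast
    then have "path_component_of (suspension RL) (Inr False) y"
      using y by (rule path_component_of_suspension)
    then have "wedge RK x (suspension RL) y homotopy_equivalent_space wedge RK x (suspension RL) (Inr False)"
      by (rule wedge_change_basepoint[OF well_pointed_realization[OF x]])
    then show ?thesis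
      using *[of False] homotopy_equivalent_space_sym homotopy_eqv_trans by blast
  qed
qed

end

section \<open>The exact sequence\<close>

text \<open>The map \<open>g\<close> is given beforehand with \<open>\<phi> \<circ> g = j\<close> on
  the carrier, so the new sequence contains this very map and not an inverse of
  \<open>\<phi>\<close> composed with \<open>j\<close>.\<close>

lemma exact_seq_replace_iso:
  assumes ex: "exact_seq ([A4, A3, R, A1, A0], [f', d, j, f])"
    and M: "group M" and \<phi>: "\<phi> \<in> iso M R" and g: "g \<in> hom A1 M"
    and j: "\<And>a. a \<in> carrier A1 \<Longrightarrow> \<phi> (g a) = j a"
  shows "exact_seq ([A4, A3, M, A1, A0], [f', d \<circ> \<phi>, g, f])"
proof -
  have ex': "group A0" "group A1" "group R" "group A3" "group A4" "f \<in> hom A0 A1" "j \<in> hom A1 R" "d \<in> hom R A3" "f' \<in> hom A3 A4"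
    "kernel A1 R j = f ` carrier A0" "kernel R A3 d = j ` carrier A1" "kernel A3 A4 f' = d ` carrier R"
    using ex by (auto simp: group_hom_def group_hom_axioms_def)
  have hom: "\<phi> \<in> hom M R" and inj: "inj_on \<phi> (carrier M)" and onto: "\<phi> ` carrier M = carrier R"
    using \<phi> by (auto simp: iso_def bij_betw_def)
  have gM: "g a \<in> carrier M" if "a \<in> carrier A1" for a
    using g that hom_in_carrier by metis
  have \<phi>1: "\<phi> \<one>\<^bsub>M\<^esub> = \<one>\<^bsub>R\<^esub>"
    using hom M ex'(3) hom_one by blast
  have "kernel A1 M g = kernel A1 R j"
  proof -
    have "g a = \<one>\<^bsub>M\<^esub> \<longleftrightarrow> j a = \<one>\<^bsub>R\<^esub>" if "a \<in> carrier A1" for a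
      using j[OF that] \<phi>1 inj_onD[OF inj, of "g a" "\<one>\<^bsub>M\<^esub>"] gM[OF that] M
      by (metis group.is_monoid monoid.one_closed)
    then show ?thesis
      by (auto simp: kernel_def)
  qed
  moreover have "kernel M A3 (d \<circ> \<phi>) = g ` carrier A1"
  proof (intro equalityI subsetI)
    fix x assume "x \<in> kernel M A3 (d \<circ> \<phi>)"
    then have x: "x \<in> carrier M" "\<phi> x \<in> kernel R A3 d"
      using hom by (auto simp: kernel_def hom_in_carrier)
    then obtain a where a: "a \<in> carrier A1" "\<phi> x = j a"
      unfolding ex'(11) by blast
    then have "x = g a"
      using j[OF a(1)] gM[OF a(1)] x(1) inj_onD[OF inj] by metis
    with a show "x \<in> g ` carrier A1"
      by blast
  next
    fix x assume "x \<in> g ` carrier A1"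
    then obtain a where a: "a \<in> carrier A1" "x = g a"
      by blast
    then have "\<phi> x \<in> kernel R A3 d"
      unfolding ex'(11) using j by auto
    then show "x \<in> kernel M A3 (d \<circ> \<phi>)"
      using a gM by (auto simp: kernel_def)
  qed
  moreover have "kernel A3 A4 f' = (d \<circ> \<phi>) ` carrier M"
    unfolding ex'(12) using onto by (metis image_comp)
  moreover have "d \<circ> \<phi> \<in> hom M A3"
    using hom ex'(8) hom_compose by blast
  ultimately show ?thesis
    using ex' g M by (simp add: group_hom_def group_hom_axioms_def)
qed

text \<open>For degrees in which the subcomplex contributes nothing to the middle. The image of
  \<open>f\<close> is assumed trivial rather than \<open>A0\<close>, since in degree -1 the complex
  \<open>{{}}\<close> makes \<open>A0\<close> infinite cyclic.\<close>

lemma exact_seq_trivial_sides: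
  assumes gr: "group A0" "group M" "trivial_group A3" "group A4"
    and f: "f \<in> hom A0 M" "f ` carrier A0 = {\<one>\<^bsub>M\<^esub>}" and f': "f' \<in> hom A3 A4"
    and j: "\<And>a. a \<in> carrier M \<Longrightarrow> j a = a"
  shows "exact_seq ([A4, A3, M, M, A0], [f', \<lambda>_. \<one>\<^bsub>A3\<^esub>, j, f])"
proof -
  have 3: "group A3" "carrier A3 = {\<one>\<^bsub>A3\<^esub>}"
    using gr(3) by (auto simp: trivial_group_def)
  interpret M: group M by (rule gr(2))
  have "j \<in> hom M M"
    using j by (auto intro!: homI)
  moreover have "kernel M M j = {\<one>\<^bsub>M\<^esub>}" "j ` carrier M = carrier M"
    using j by (force simp: kernel_def)+
  moreover have "f' \<one>\<^bsub>A3\<^esub> = \<one>\<^bsub>A4\<^esub>"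
    using f' gr(4) 3(1) hom_one by blast
  then have "kernel A3 A4 f' = {\<one>\<^bsub>A3\<^esub>}"
    using 3(2) by (auto simp: kernel_def)
  moreover have "(\<lambda>_. \<one>\<^bsub>A3\<^esub>) \<in> hom M A3"
    using 3(1) by (simp add: hom_def group.is_monoid monoid.one_closed)
  ultimately show ?thesis
    using gr 3(1) f f' M.one_closed by (auto simp: group_hom_def group_hom_axioms_def kernel_def)
qed

text \<open>The degree 0 part for the subcomplex \<open>{{}}\<close>: reduced homology is the kernel
  of the augmentation, and the augmentation of a nonempty space is onto. The one-point space at
  \<open>u\<close> stands for the integers in degree -1.\<close>

lemma exact_seq_empty_subspace:
  assumes X: "topspace X \<noteq> {}" and Y: "topspace Y = {}"
  shows "exact_seq ([reduced_homology_group (-1) X, homology_group 0 (discrete_topology {u}),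
      homology_group 0 X, reduced_homology_group 0 X, reduced_homology_group 0 Y],
      [\<lambda>_. \<one>\<^bsub>reduced_homology_group (-1) X\<^esub>, hom_induced 0 X {} (discrete_topology {u}) {} (\<lambda>_. u),
       hom_induced 0 X {} X {} id, hom_induced 0 Y {} X {} id])"
proof -
  let ?U = "discrete_topology {u}" and ?P = "discrete_topology {()}"
  let ?aug = "hom_induced 0 X {} ?U {} (\<lambda>_. u)"
  let ?RX = "reduced_homology_group 0 X" and ?HX = "homology_group 0 X" and ?HU = "homology_group 0 ?U"
  let ?N = "reduced_homology_group (-1) X"
  have cont: "continuous_map X ?U (\<lambda>_. u)" "continuous_map ?U ?P (\<lambda>_. ())" "continuous_map ?P ?U (\<lambda>_. u)"
    by auto
  \<comment> \<open>Reduced homology is defined by the map to the one-point space on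
    \<open>()\<close>. Passing between the two one-point spaces in both directions shows that the
    kernels agree.\<close>
  have aug: "hom_induced 0 X {} ?P {} (\<lambda>_. ()) c = hom_induced 0 ?U {} ?P {} (\<lambda>_. ()) (?aug c)" for c
    using hom_induced_compose_empty[OF cont(1,2), of 0] by (simp add: o_def)
  have aug': "?aug c = hom_induced 0 ?P {} ?U {} (\<lambda>_. u) (hom_induced 0 X {} ?P {} (\<lambda>_. ()) c)" for c
    using hom_induced_compose_empty[of X ?P "\<lambda>_. ()" ?U "\<lambda>_. u" 0] by (simp add: o_def)
  have one: "hom_induced 0 ?U {} ?P {} (\<lambda>_. ()) \<one>\<^bsub>?HU\<^esub> = \<one>\<^bsub>homology_group 0 ?P\<^esub>"
    "hom_induced 0 ?P {} ?U {} (\<lambda>_. u) \<one>\<^bsub>homology_group 0 ?P\<^esub> = \<one>\<^bsub>?HU\<^esub>"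
    by (rule hom_one[OF hom_induced_empty_hom]; simp)+
  have ker_aug: "kernel ?HX ?HU ?aug = carrier ?RX"
    unfolding carrier_reduced_homology_group kernel_def using aug aug' one by (metis (no_types, lifting))
  obtain a where a: "a \<in> topspace X"
    using X by blast
  have "?aug ` carrier ?HX = carrier ?HU"
  proof (intro equalityI subsetI)
    fix c assume c: "c \<in> carrier ?HU"
    \<comment> \<open>The inclusion of the point \<open>a\<close> is a section of the
      augmentation.\<close>
    have "?aug (hom_induced 0 ?U {} X {} (\<lambda>_. a) c) = hom_induced 0 ?U {} ?U {} (\<lambda>_. u) c"
      using hom_induced_compose_empty[of ?U X "\<lambda>_. a" ?U "\<lambda>_. u" 0] a by (simp add: o_def)
    also have "\<dots> = c"
      by (rule hom_induced_id_gen[OF _ _ c]) auto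
    finally show "c \<in> ?aug ` carrier ?HX"
      using hom_in_carrier[OF hom_induced_empty_hom c] by (metis image_eqI)
  qed (use hom_in_carrier[OF hom_induced_empty_hom] in blast)
  have id: "hom_induced 0 X {} X {} id c = c" if "c \<in> carrier ?RX" for c
    using that carrier_reduced_homology_group_subset[of 0 X] hom_induced_id by blast
  have idhom: "hom_induced 0 X {} X {} id \<in> hom ?RX ?HX"
    by (simp add: group.hom_from_subgroup_generated hom_induced_hom reduced_homology_group_def)
  have triv: "carrier (reduced_homology_group 0 Y) = {\<one>\<^bsub>reduced_homology_group 0 Y\<^esub>}"
    using trivial_reduced_homology_group_empty[OF Y] by (simp add: trivial_group_def)
  have f1: "hom_induced 0 Y {} X {} id \<one>\<^bsub>reduced_homology_group 0 Y\<^esub> = \<one>\<^bsub>?RX\<^esub>"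
    by (rule hom_one[OF hom_induced_reduced_hom]) simp_all
  have "kernel ?RX ?HX (hom_induced 0 X {} X {} id) = {\<one>\<^bsub>?RX\<^esub>}"
    using id by (auto simp: kernel_def one_reduced_homology_group) (metis group.is_monoid group_reduced_homology_group monoid.one_closed one_reduced_homology_group)+
  then have k1: "kernel ?RX ?HX (hom_induced 0 X {} X {} id) = hom_induced 0 Y {} X {} id ` carrier (reduced_homology_group 0 Y)"
    using triv f1 by simp
  have k2: "kernel ?HX ?HU ?aug = hom_induced 0 X {} X {} id ` carrier ?RX"
    using ker_aug id by force
  have k3: "kernel ?HU ?N (\<lambda>_. \<one>\<^bsub>?N\<^esub>) = ?aug ` carrier ?HX"
    using \<open>?aug ` carrier ?HX = carrier ?HU\<close> by (simp add: kernel_def)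
  have "(\<lambda>_. \<one>\<^bsub>?N\<^esub>) \<in> hom ?HU ?N"
    by (simp add: hom_def group.is_monoid monoid.one_closed)
  then show ?thesis
    using k1 k2 k3 idhom by (simp add: group_hom_def group_hom_axioms_def hom_induced_reduced_hom hom_induced_empty_hom)
qed

section \<open>Comparison of the coned complex with the pair formed by \<open>K\<close> and
  \<open>L\<close>\<close>

context coned_subcomplex
begin

lemma contractible_space_cone: "contractible_space RA"
proof -
  have "continuous_map (prod_topology unit_interval RA) RA (\<lambda>p i. (1 - fst p) * snd p i + fst p * vertex v i)"
  proof (rule A.continuous_map_convex_combination)
    fix p assume p: "p \<in> topspace (prod_topology unit_interval RA)"
    then have "support (snd p) - {v} \<in> L"
      using support_cone[of "snd p"] by auto
    moreover have eq: "support (snd p) \<union> support (vertex v) = insert v (support (snd p) - {v})"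
      by (auto simp: vertex_def)
    ultimately show "support (snd p) \<union> support (vertex v) \<in> subcone"
      unfolding eq by blast
  qed (use apex_in_cone continuous_map_snd continuous_map_real_fst in auto)
  then have "homotopic_with (\<lambda>_. True) RA RA id (\<lambda>_. vertex v)"
    by (rule homotopic_withI_True) auto
  then show ?thesis
    unfolding contractible_space_def by blast
qed

text \<open>A positive apex coordinate is an open condition that forces a point into the cone, so
  the closed point at the apex lies in the interior. Only this point is excised: the closure of the
  whole open cone reaches \<open>RL\<close>, which need not be interior.\<close>

lemma excision_iso:
  "hom_induced p (subtopology RM (topspace RM - {vertex v})) (topspace RA - {vertex v}) RM (topspace RA) id
    \<in> iso (relative_homology_group p (subtopology RM (topspace RM - {vertex v})) (topspace RA - {vertex v}))
        (relative_homology_group p RM (topspace RA))"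
proof -
  have "openin RM {b \<in> topspace RM. b v \<in> {0<..}}"
    by (rule openin_continuous_map_preimage[OF continuous_map_realization_coordinate]) auto
  moreover have "{b \<in> topspace RM. b v \<in> {0<..}} \<subseteq> topspace RA"
  proof
    fix b assume "b \<in> {b \<in> topspace RM. b v \<in> {0<..}}"
    then have b: "b \<in> topspace RM" "b v \<noteq> 0"
      by auto
    then show "b \<in> topspace RA"
      using realization_Un apex_coordinate_0 by blast
  qed
  ultimately have "{b \<in> topspace RM. b v \<in> {0<..}} \<subseteq> RM interior_of (topspace RA)"
    by (simp add: interior_of_maximal)
  moreover have vM: "vertex v \<in> topspace RM"
    using apex_in_cone realization_subset by blast
  ultimately have "{vertex v} \<subseteq> RM interior_of (topspace RA)"
    by (auto simp: vertex_def)
  moreover have "RM closure_of {vertex v} = {vertex v}"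
    using vM closedin_Hausdorff_sing_eq[OF Hausdorff_space_realization, of coned "vertex v"] by (simp add: closure_of_eq)
  ultimately show ?thesis
    using homology_excision_axiom[of RM "{vertex v}" "topspace RA" "topspace RM" p] realization_subset(2)
    by simp
qed

text \<open>Radial projection \<open>r\<close> from the missing apex deletes the apex coordinate and
  rescales; it is defined because that coordinate is below 1 elsewhere. The segment from
  \<open>r b\<close> to \<open>b\<close> stays in the face carrying \<open>b\<close>, hence respects
  the pair.\<close>

lemma punctured_iso:
  "hom_induced p RK (topspace RL) (subtopology RM (topspace RM - {vertex v})) (topspace RA - {vertex v}) id
    \<in> iso (relative_homology_group p RK (topspace RL))
        (relative_homology_group p (subtopology RM (topspace RM - {vertex v})) (topspace RA - {vertex v}))"
proof -
  let ?X = "subtopology RM (topspace RM - {vertex v})" and ?S = "topspace RA - {vertex v}"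
  define r :: "('a \<Rightarrow> real) \<Rightarrow> 'a \<Rightarrow> real" where "r b i = (if i = v then 0 else b i / (1 - b v))" for b i
  have tX: "topspace ?X = topspace RM - {vertex v}"
    by auto
  have lt1: "b v < 1" if "b \<in> topspace ?X" for b
  proof -
    have "b \<in> topspace RM" "b \<noteq> vertex v"
      using that by auto
    then show ?thesis
      using apex_coordinate_0[of b] by (cases rule: coned_cases) auto
  qed
  have supr: "support (r b) = support b - {v}" if "b \<in> topspace ?X" for b
    using lt1[OF that] by (auto simp: r_def)
  have rK: "r b \<in> topspace RK" if b: "b \<in> topspace ?X" for b
  proof -
    define w where "w i = (if i = v then 0 else b i)" for i
    have bM: "b \<in> topspace RM"
      using b by auto
    have "sum w V = sum b V"
      using apex by (intro sum.cong) (auto simp: w_def)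
    also have "\<dots> = 1 - b v"
      using bM finite_vertices apex by (simp add: M.mem_realization del: Un_iff)
    finally have sw: "sum w V = 1 - b v" .
    have "support w = support b - {v}"
      by (auto simp: w_def)
    moreover have "support b - {v} \<in> K"
      using support_in_complex[OF bM] apex_coordinate_pos[OF bM] subcomplex by (cases "b v = 0") (auto dest: not_apex)
    ultimately have "(\<lambda>i. w i / sum w V) \<in> topspace RK"
      using realization_nonneg[OF bM] sw lt1[OF b] by (intro normalise_in_realization) (auto simp: w_def)
    moreover have "(\<lambda>i. w i / sum w V) = r b"
      unfolding sw by (auto simp: w_def r_def)
    ultimately show ?thesis by simp
  qed
  have KX: "topspace RK \<subseteq> topspace ?X"
    using realization_subset(1) apex_coordinate_0[of "vertex v"] by (auto simp: vertex_def)
  have rid: "r b = b" if "b \<in> topspace RK" for b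
    using apex_coordinate_0[OF that] by (auto simp: r_def)
  have coord: "continuous_map ?X euclideanreal (\<lambda>b. b i)" for i
    by (intro continuous_map_from_subtopology continuous_map_realization_coordinate)
  have contr: "continuous_map ?X RK r"
    unfolding continuous_map_realization_iff
  proof (intro conjI allI ballI rK)
    fix i
    have "continuous_map ?X euclideanreal (\<lambda>b. b i / (1 - b v))"
      using lt1 by (intro continuous_intros coord) fastforce+
    then show "continuous_map ?X euclideanreal (\<lambda>b. r b i)"
      by (cases "i = v") (simp_all add: r_def)
  qed
  have "RK = subtopology ?X (topspace RK)"
    using KX realization_eq(1) by (simp add: subtopology_subtopology inf.absorb2)
  then have contid: "continuous_map RK ?X id"
    using continuous_map_id_subt by metis
  have L: "topspace RL = topspace RK \<inter> topspace RA"
    by (rule realization_Int[symmetric])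
  have rL: "r b \<in> topspace RL" if "b \<in> ?S" for b
  proof -
    have b: "b \<in> topspace ?X" "b \<in> topspace RA"
      using that realization_subset(2) by auto
    then have "support (r b) \<in> L"
      using support_cone supr by metis
    then show ?thesis
      using topspace_realization_subset_iff[OF rK[OF b(1)]] by blast
  qed
  have gf: "homotopic_with (\<lambda>h. h \<in> topspace RL \<rightarrow> topspace RL) RK RK (r \<circ> id) id"
  proof (rule homotopic_with_equal)
    show "continuous_map RK RK (r \<circ> id)"
      by (rule continuous_map_compose[OF contid contr])
    show "r \<circ> id \<in> topspace RL \<rightarrow> topspace RL"
      using rid realization_subset(3) by auto
  qed (auto simp: rid)
  have fg: "homotopic_with (\<lambda>k. k \<in> ?S \<rightarrow> ?S) ?X ?X (id \<circ> r) id"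
  proof -
    let ?h = "\<lambda>p i. (1 - fst p) * r (snd p) i + fst p * snd p i"
    let ?I = "prod_topology unit_interval ?X"
    have hM: "continuous_map ?I RM ?h"
    proof (rule M.continuous_map_convex_combination)
      show "continuous_map ?I RM (\<lambda>p. r (snd p))"
        using continuous_map_into_fulltopology[OF continuous_map_compose2[OF contid contr]]
        by (intro continuous_map_compose2[OF _ continuous_map_snd]) simp
      show "continuous_map ?I RM (\<lambda>p. snd p)"
        using continuous_map_snd continuous_map_into_fulltopology by blast
      fix p assume p: "p \<in> topspace ?I"
      then have "support (r (snd p)) \<union> support (snd p) = support (snd p)" "snd p \<in> topspace RM"
        using supr[of "snd p"] by auto
      then show "support (r (snd p)) \<union> support (snd p) \<in> coned"
        using support_in_complex by metis
    qed (auto intro: continuous_map_real_fst)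
    \<comment> \<open>As \<open>r\<close> has apex coordinate 0, the segment has a fraction of the
      original one, so it never meets the apex.\<close>
    have hv: "?h p v < 1" if "p \<in> topspace ?I" for p
    proof -
      have "fst p * snd p v \<le> 1 * snd p v"
        using that realization_nonneg[of "snd p" coned v] by (intro mult_right_mono) auto
      moreover have "snd p v < 1"
        using that by (intro lt1) auto
      ultimately show ?thesis
        by (simp add: r_def)
    qed
    have hX: "continuous_map ?I ?X ?h"
    proof (rule continuous_map_into_subtopology[OF hM])
      have "?h p \<noteq> vertex v" if "p \<in> topspace ?I" for p
        using hv[OF that] by (metis less_irrefl vertex_def)
      then show "?h \<in> topspace ?I \<rightarrow> topspace RM - {vertex v}"
        using continuous_map_funspace[OF hM] by blast
    qed
    have hS: "?h (t, b) \<in> ?S" if t: "t \<in> {0..1}" and b: "b \<in> ?S" for t b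
    proof -
      have bX: "b \<in> topspace ?X"
        using b realization_subset(2) by auto
      then have X: "?h (t, b) \<in> topspace RM - {vertex v}"
        using funcset_mem[OF continuous_map_funspace[OF hX], of "(t, b)"] t unfolding topspace_prod_topology tX by simp
      have "?h (t, b) i = 0" if "b i = 0" for i
        using that by (simp add: r_def)
      then have "support (?h (t, b)) \<subseteq> support b"
        by blast
      moreover have "support b \<in> subcone"
        using b support_in_complex[of b subcone] by simp
      ultimately have sup: "support (?h (t, b)) \<in> subcone"
        using A.face_subset[of "support b" "support (?h (t, b))"] by (simp only: simp_thms)
      have "?h (t, b) \<in> topspace RA"
        using sup topspace_realization_subset_iff[of "?h (t, b)" coned subcone] X by (simp only: Diff_iff simp_thms)
      with X show ?thesis
        by (simp only: Diff_iff simp_thms)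
    qed
    show ?thesis
      unfolding homotopic_with_def
    proof (intro exI[of _ ?h] conjI allI ballI hX)
      fix t :: real assume "t \<in> {0..1}"
      then show "(\<lambda>b. ?h (t, b)) \<in> ?S \<rightarrow> ?S"
        using hS by blast
    qed auto
  qed
  show ?thesis
  proof (rule homotopy_equivalence_relative_homology_group_isomorphism[OF contid _ contr _ gf fg])
    show "id \<in> topspace RL \<rightarrow> ?S"
      using L KX by auto
    show "r \<in> ?S \<rightarrow> topspace RL"
      using rL by blast
  qed
qed

text \<open>Both groups are compared with the homology of \<open>RM\<close> relative to the
  contractible cone. The second clause holds because both ways from \<open>RK\<close> into that pair
  are the same inclusion; it is what later makes the middle map of the sequence the one induced by
  inclusion.\<close>

lemma relative_homology_iso:
  "\<exists>\<phi> \<in> iso (reduced_homology_group p RM) (relative_homology_group p RK (topspace RL)).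
     \<forall>c \<in> carrier (reduced_homology_group p RK).
       \<phi> (hom_induced p RK {} RM {} id c) = hom_induced p RK {} RK (topspace RL) id c"
proof -
  let ?X = "subtopology RM (topspace RM - {vertex v})" and ?S = "topspace RA - {vertex v}"
  let ?\<Theta> = "hom_induced p RK (topspace RL) RM (topspace RA) id" and ?\<Psi> = "hom_induced p RM {} RM (topspace RA) id"
  let ?R = "relative_homology_group p RK (topspace RL)" and ?Q = "relative_homology_group p RM (topspace RA)"
  have contKM: "continuous_map RK RM id"
    using realization_eq(1) continuous_map_id_subt by metis
  have KX: "topspace RK \<subseteq> topspace RM - {vertex v}"
    using realization_subset(1) apex_coordinate_0[of "vertex v"] by (auto simp: vertex_def)
  have contKX: "continuous_map RK ?X id"
    using contKM KX by (auto simp: continuous_map_in_subtopology)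
  have LA: "topspace RL \<subseteq> topspace RA" "topspace RL \<subseteq> ?S"
    using realization_Int KX by auto
  have "?\<Theta> = hom_induced p ?X ?S RM (topspace RA) id \<circ> hom_induced p RK (topspace RL) ?X ?S id"
    using hom_induced_compose[OF contKX _ continuous_map_id_subt, of "topspace RL" ?S "topspace RA" p] LA(2) by (simp add: Pi_iff subset_iff)
  then have \<Theta>: "?\<Theta> \<in> iso ?R ?Q"
    using iso_set_trans[OF punctured_iso excision_iso] by simp
  have "RA = subtopology RM (topspace RA)"
    by (rule realization_eq(2))
  then have \<Psi>: "?\<Psi> \<in> iso (reduced_homology_group p RM) ?Q"
    using contractible_space_cone apex_in_cone realization_subset(2)
    by (intro iso_reduced_homology_by_contractible) auto
  let ?\<phi> = "inv_into (carrier ?R) ?\<Theta> \<circ> ?\<Psi>"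
  show ?thesis
  proof (intro bexI[of _ ?\<phi>] ballI)
    show "?\<phi> \<in> iso (reduced_homology_group p RM) ?R"
      using iso_set_trans[OF \<Psi> group.iso_set_sym[OF _ \<Theta>]] by simp
    fix c assume c: "c \<in> carrier (reduced_homology_group p RK)"
    let ?J = "hom_induced p RK {} RK (topspace RL) id"
    have "?\<Psi> (hom_induced p RK {} RM {} id c) = hom_induced p RK {} RM (topspace RA) id c"
      using hom_induced_compose'[OF contKM, of "{}" "{}" RM id "topspace RA" p c] by simp
    also have "\<dots> = ?\<Theta> (?J c)"
      using hom_induced_compose'[OF _ _ contKM, of RK id "{}" "topspace RL" "topspace RA" p c] LA(1) by (simp add: Pi_iff subset_iff)
    finally have "?\<phi> (hom_induced p RK {} RM {} id c) = inv_into (carrier ?R) ?\<Theta> (?\<Theta> (?J c))"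
      by simp
    also have "\<dots> = ?J c"
    proof (rule inv_into_f_f)
      show "inj_on ?\<Theta> (carrier ?R)"
        using \<Theta> by (simp add: iso_def bij_betw_def)
      have "c \<in> carrier (homology_group p RK)"
        using c carrier_reduced_homology_group_subset by blast
      then show "?J c \<in> carrier ?R"
        by (rule hom_in_carrier[OF hom_induced_hom])
    qed
    finally show "?\<phi> (hom_induced p RK {} RM {} id c) = ?J c" .
  qed
qed

lemma exact_seq_pair:
  assumes "topspace RL \<noteq> {}"
  shows "exact_seq ([reduced_homology_group (i - 1) RK, reduced_homology_group (i - 1) RL,
      relative_homology_group i RK (topspace RL), reduced_homology_group i RK, reduced_homology_group i RL],
      [hom_induced (i - 1) RL {} RK {} id, hom_boundary i RK (topspace RL),
       hom_induced i RK {} RK (topspace RL) id, hom_induced i RL {} RK {} id])"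
proof -
  have "topspace RK \<inter> topspace RL \<noteq> {}"
    using assms realization_subset(3) by blast
  note 1 = homology_exactness_reduced_1[OF this, of i, folded realization_eq(3)]
    and 2 = homology_exactness_reduced_2[of i RK "topspace RL", folded realization_eq(3)]
    and 3 = homology_exactness_reduced_3[of i RK "topspace RL", folded realization_eq(3)]
  show ?thesis
    using 1 2 3 by simp
qed

end

section \<open>Total cut complexes\<close>

text \<open>\<open>independent_set\<close> also tests the degenerate pair with
  \<open>x = y\<close>.\<close>

lemma singleton_not_edge: "finite_simple_graph G \<Longrightarrow> {x} \<notin> snd G"
  by (auto simp: finite_simple_graph_def)

lemma independent_set_remove: "independent_set G S \<Longrightarrow> independent_set G (S - {s})"
  by (auto simp: independent_set_def)

lemma total_cut_complex_add_isolated_vertex: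
  assumes G: "finite_simple_graph G" and v: "v \<notin> fst G" and k: "k \<ge> 1"
  shows "total_cut_complex k (add_isolated_vertex G v) =
    total_cut_complex (k - 1) G \<union> insert v ` total_cut_complex k G"
proof -
  have fin: "finite (fst G)" and edge: "\<And>e. e \<in> snd G \<Longrightarrow> e \<subseteq> fst G \<and> card e = 2"
    using G by (auto simp: finite_simple_graph_def)
  have ind: "independent_set (add_isolated_vertex G v) S \<longleftrightarrow> S \<subseteq> insert v (fst G) \<and> independent_set G (S - {v})" for S
    using edge v singleton_not_edge[OF G] unfolding independent_set_def add_isolated_vertex_def by auto blast+
  show ?thesis
  proof (intro equalityI subsetI)
    fix F assume "F \<in> total_cut_complex k (add_isolated_vertex G v)"
    then obtain S where S: "S \<subseteq> insert v (fst G)" "independent_set G (S - {v})" "card S = k" "F \<subseteq> insert v (fst G) - S"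
      by (auto simp: total_cut_complex_def ind) (simp add: add_isolated_vertex_def)
    show "F \<in> total_cut_complex (k - 1) G \<union> insert v ` total_cut_complex k G"
    proof (cases "v \<in> S")
      case True
      then have "F \<in> total_cut_complex (k - 1) G"
        using S by (auto simp: total_cut_complex_def intro!: exI[of _ "S - {v}"])
      then show ?thesis by simp
    next
      case False
      then have *: "F' \<in> total_cut_complex k G" if "F' \<subseteq> fst G - S" for F'
        using S that by (auto simp: total_cut_complex_def)
      show ?thesis
      proof (cases "v \<in> F")
        case True
        then have "F = insert v (F - {v})" "F - {v} \<in> total_cut_complex k G"
          using S(4) * [of "F - {v}"] by auto
        then show ?thesis by blast
      next
        case False
        \<comment> \<open>Here \<open>F\<close> is a face of \<open>L\<close>; giving up any element
          of \<open>S\<close> enlarges the complement and makes \<open>F\<close> a face of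
          \<open>K\<close>.\<close>
        obtain s where s: "s \<in> S"
          using S(3) k by fastforce
        have "independent_set G (S - {s})" "card (S - {s}) = k - 1" "F \<subseteq> fst G - (S - {s})"
          using S False \<open>v \<notin> S\<close> s independent_set_remove[of G S s] by auto
        then show ?thesis
          by (auto simp: total_cut_complex_def)
      qed
    qed
  next
    fix F assume "F \<in> total_cut_complex (k - 1) G \<union> insert v ` total_cut_complex k G"
    then show "F \<in> total_cut_complex k (add_isolated_vertex G v)"
    proof
      assume "F \<in> total_cut_complex (k - 1) G"
      then obtain S where S: "independent_set G S" "card S = k - 1" "F \<subseteq> fst G - S"
        by (auto simp: total_cut_complex_def)
      then have "S \<subseteq> fst G" "v \<notin> S" "finite S"
        using v fin finite_subset by (auto simp: independent_set_def)
      then have "independent_set (add_isolated_vertex G v) (insert v S)" "card (insert v S) = k"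
        "F \<subseteq> fst (add_isolated_vertex G v) - insert v S"
        using S k v unfolding ind by (auto simp: add_isolated_vertex_def)
      then show ?thesis
        unfolding total_cut_complex_def by blast
    next
      assume "F \<in> insert v ` total_cut_complex k G"
      then obtain F' S where S: "independent_set G S" "card S = k" "F' \<subseteq> fst G - S" "F = insert v F'"
        by (auto simp: total_cut_complex_def)
      then have "S \<subseteq> fst G" "v \<notin> S"
        using v by (auto simp: independent_set_def)
      then have "independent_set (add_isolated_vertex G v) S" "F \<subseteq> fst (add_isolated_vertex G v) - S"
        using S unfolding ind by (auto simp: add_isolated_vertex_def)
      then show ?thesis
        unfolding total_cut_complex_def using S(2) by blast
    qed
  qed
qed

lemma total_cut_complex_mono:
  assumes "k \<ge> 1"
  shows "total_cut_complex k G \<subseteq> total_cut_complex (k - 1) G"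
proof
  fix F assume "F \<in> total_cut_complex k G"
  then obtain S where S: "independent_set G S" "card S = k" "F \<subseteq> fst G - S"
    by (auto simp: total_cut_complex_def)
  obtain s where s: "s \<in> S"
    using S(2) assms by fastforce
  then have "independent_set G (S - {s})" "card (S - {s}) = k - 1"
    using S independent_set_remove[of G S s] by auto
  then show "F \<in> total_cut_complex (k - 1) G"
    using S(3) by (auto simp: total_cut_complex_def)
qed

lemma finite_complex_total_cut_complex:
  assumes "finite_simple_graph G"
  shows "finite_complex (fst G) (total_cut_complex j G)"
proof
  show "finite (fst G)"
    using assms by (simp add: finite_simple_graph_def)
  show "total_cut_complex j G \<subseteq> Pow (fst G)"
    by (auto simp: total_cut_complex_def)
  show "F' \<in> total_cut_complex j G" if "F \<in> total_cut_complex j G" "F' \<subseteq> F" for F F'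
    using that unfolding total_cut_complex_def by blast
qed

text \<open>One element of \<open>S\<close> is given up, namely \<open>x\<close> itself if it is in
  \<open>S\<close>; afterwards \<open>x\<close> and \<open>w\<close> are both in the
  complement.\<close>

lemma total_cut_complex_edge:
  assumes k: "k \<ge> 1" and w: "{w} \<in> total_cut_complex k G" and x: "x \<in> fst G"
  shows "{x, w} \<in> total_cut_complex (k - 1) G"
proof -
  obtain S where S: "independent_set G S" "card S = k" "w \<in> fst G - S"
    using w by (auto simp: total_cut_complex_def)
  have "S \<noteq> {}"
    using S(2) k by auto
  then obtain s where s: "s \<in> S" "x \<in> S \<longrightarrow> s = x"
    by blast
  then have "independent_set G (S - {s})" "card (S - {s}) = k - 1" "{x, w} \<subseteq> fst G - (S - {s})"
    using S x independent_set_remove[of G S s] by auto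
  then show ?thesis
    by (auto simp: total_cut_complex_def)
qed

text \<open>The element given up from \<open>S\<close> is such a vertex. It makes
  \<open>complex_reduced_homology\<close> of \<open>K\<close> and of the coned complex ordinary
  reduced homology in all degrees.\<close>

lemma total_cut_complex_has_vertex:
  assumes G: "finite_simple_graph G" and k: "k \<ge> 2" and ne: "total_cut_complex k G \<noteq> {}"
  shows "\<exists>x. {x} \<in> total_cut_complex (k - 1) G"
proof -
  obtain S where S: "independent_set G S" "card S = k"
    using ne by (auto simp: total_cut_complex_def)
  then obtain s where s: "s \<in> S"
    using k by fastforce
  then have "independent_set G (S - {s})" "card (S - {s}) = k - 1" "{s} \<subseteq> fst G - (S - {s})"
    using S independent_set_remove[of G S s] by (auto simp: independent_set_def)
  then show ?thesis
    by (auto simp: total_cut_complex_def)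
qed

lemma realization_empty_iff:
  assumes "finite_complex V K"
  shows "topspace (realization K) = {} \<longleftrightarrow> K \<subseteq> {{}}"
proof
  assume e: "topspace (realization K) = {}"
  show "K \<subseteq> {{}}"
  proof
    fix F assume F: "F \<in> K"
    have False if "x \<in> F" for x
      using finite_complex.face_subset[OF assms F, of "{x}"] finite_complex.vertex_in_realization[OF assms, of x] e that by auto
    then show "F \<in> {{}}" by blast
  qed
next
  assume "K \<subseteq> {{}}"
  then show "topspace (realization K) = {}"
    using support_in_complex support_nonempty by blast
qed

lemma complex_reduced_homology_nonempty:
  "{x} \<in> K \<Longrightarrow> complex_reduced_homology i K = reduced_homology_group i (realization K)"
  by (auto simp: complex_reduced_homology_def)

text \<open>Here the third complex is \<open>K\<close> again. In negative degrees the maps are set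
  by hand, because \<open>K\<close> may be \<open>{{}}\<close>, whose group in degree -1 is not a
  homology group of its realization.\<close>

lemma exact_seq_void_subcomplex:
  fixes K :: "'a set set"
  shows "\<exists>f g d :: int \<Rightarrow> ('a \<Rightarrow> real) chain set \<Rightarrow> ('a \<Rightarrow> real) chain set.
    (\<forall>i\<ge>0. f i = hom_induced i (realization {}) {} (realization K) {} id) \<and>
    (\<forall>i\<ge>0. g i = hom_induced i (realization K) {} (realization K) {} id) \<and>
    (\<forall>i. exact_seq ([complex_reduced_homology (i - 1) K, complex_reduced_homology (i - 1) {},
        complex_reduced_homology i K, complex_reduced_homology i K, complex_reduced_homology i {}],
        [f (i - 1), d i, g i, f i]))"
proof -
  let ?H = "complex_reduced_homology"
  define f where "f i = (if i \<ge> 0 then hom_induced i (realization ({} :: 'a set set)) {} (realization K) {} id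
      else (\<lambda>_. \<one>\<^bsub>?H i K\<^esub>))" for i :: int
  define g where "g i = (if i \<ge> 0 then hom_induced i (realization K) {} (realization K) {} id else id)" for i :: int
  have grp: "group (?H i X)" for i and X :: "'a set set"
    by (simp add: complex_reduced_homology_def)
  have triv: "trivial_group (?H i ({} :: 'a set set))" for i
    unfolding complex_reduced_homology_def
    by (simp add: trivial_reduced_homology_group_empty topspace_realization)
  have f: "f i \<in> hom (?H i {}) (?H i K)" for i
  proof (cases "i \<ge> 0")
    case True
    then show ?thesis
      by (simp add: f_def complex_reduced_homology_def hom_induced_reduced_hom)
  next
    case False
    then show ?thesis
      using grp[of i K] by (simp add: f_def hom_def group.is_monoid monoid.one_closed)
  qed
  have f1: "f i ` carrier (?H i {}) = {\<one>\<^bsub>?H i K\<^esub>}" for i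
    using triv[of i] hom_one[OF f grp grp, of i] by (simp add: trivial_group_def)
  have g: "g i a = a" if "a \<in> carrier (?H i K)" for i a
  proof (cases "i \<ge> 0")
    case True
    then have "a \<in> carrier (homology_group i (realization K))"
      using that carrier_reduced_homology_group_subset[of i "realization K"] by (auto simp: complex_reduced_homology_def)
    then show ?thesis
      using True by (simp add: g_def hom_induced_id)
  qed (simp add: g_def)
  have "exact_seq ([?H (i - 1) K, ?H (i - 1) {}, ?H i K, ?H i K, ?H i {}],
      [f (i - 1), \<lambda>_. \<one>\<^bsub>?H (i - 1) {}\<^esub>, g i, f i])" for i
    by (rule exact_seq_trivial_sides[OF grp grp triv grp f f1 f g])
  then show ?thesis
    by (intro exI[of _ f] exI[of _ g] exI[of _ "\<lambda>i _. \<one>\<^bsub>?H (i - 1) {}\<^esub>"]) (auto simp: f_def g_def)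
qed

section \<open>The sequence of the pair, also when \<open>L\<close> has only the empty face, and its
  transfer to the coned complex\<close>

context coned_subcomplex
begin

lemma exact_seq_relative:
  assumes vert: "{x} \<in> K"
  shows "\<exists>f d :: int \<Rightarrow> ('a \<Rightarrow> real) chain set \<Rightarrow> ('a \<Rightarrow> real) chain set. (\<forall>i\<ge>0. f i = hom_induced i RL {} RK {} id) \<and>
    (\<forall>i. exact_seq ([complex_reduced_homology (i - 1) K, complex_reduced_homology (i - 1) L,
        relative_homology_group i RK (topspace RL), complex_reduced_homology i K, complex_reduced_homology i L],
        [f (i - 1), d i, hom_induced i RK {} RK (topspace RL) id, f i]))"
proof (cases "topspace RL = {}")
  case False
  then have "L \<noteq> {{}}"
    using realization_empty_iff[OF finite_complex_L] by auto
  then have "complex_reduced_homology i L = reduced_homology_group i RL" for i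
    by (simp add: complex_reduced_homology_def)
  then show ?thesis
    using exact_seq_pair[OF False] complex_reduced_homology_nonempty[OF vert]
    by (intro exI[of _ "\<lambda>i. hom_induced i RL {} RK {} id"] exI[of _ "\<lambda>i. hom_boundary i RK (topspace RL)"]) simp
next
  case empty: True
  have L: "L = {{}}"
    using realization_empty_iff[OF finite_complex_L] empty subcomplex_nonempty by blast
  let ?H = "complex_reduced_homology"
  let ?U = "discrete_topology {\<lambda>_::'a. 0::real}"
  have HK: "?H i K = reduced_homology_group i RK" for i
    by (rule complex_reduced_homology_nonempty[OF vert])
  have HL: "?H i L = reduced_homology_group i RL" if "i \<noteq> -1" for i
    using that by (simp add: complex_reduced_homology_def)
  have HL1: "?H (-1) L = homology_group 0 ?U"
    by (simp add: complex_reduced_homology_def L)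
  \<comment> \<open>In degree -1 the source stands for the integers and is not a homology group of
    \<open>RL\<close>. The map out of it is trivial, so exactness makes the augmentation
    \<open>d 0\<close> surjective.\<close>
  define f where "f i = (if i = -1 then (\<lambda>_. \<one>\<^bsub>?H i K\<^esub>) else hom_induced i RL {} RK {} id)" for i :: int
  define d where "d i = (if i = 0 then hom_induced 0 RK {} ?U {} (\<lambda>_ _. 0) else (\<lambda>_. \<one>\<^bsub>?H (i - 1) L\<^esub>))" for i :: int
  have grp: "group (?H i X)" for i and X :: "'a set set"
    by (simp add: complex_reduced_homology_def)
  have triv: "trivial_group (?H i L)" if "i \<noteq> -1" for i
    unfolding HL[OF that] using empty by (rule trivial_reduced_homology_group_empty)
  have f: "f i \<in> hom (?H i L) (?H i K)" for i
  proof (cases "i = -1")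
    case True
    then show ?thesis
      using grp[of "-1" K] by (simp add: f_def hom_def group.is_monoid monoid.one_closed)
  next
    case False
    then show ?thesis
      by (simp add: f_def HL HK hom_induced_reduced_hom)
  qed
  have f1: "f i ` carrier (?H i L) = {\<one>\<^bsub>?H i K\<^esub>}" for i
  proof (cases "i = -1")
    case True
    moreover have "carrier (?H (-1) L) \<noteq> {}"
      using grp[of "-1" L] group.is_monoid monoid.one_closed by blast
    ultimately show ?thesis
      by (auto simp: f_def)
  next
    case False
    then show ?thesis
      using triv[OF False] hom_one[OF f grp grp, of i] by (simp add: trivial_group_def)
  qed
  have "exact_seq ([?H (i - 1) K, ?H (i - 1) L, homology_group i RK, ?H i K, ?H i L],
        [f (i - 1), d i, hom_induced i RK {} RK {} id, f i])" for i
  proof (cases "i = 0")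
    case True
    have "topspace RK \<noteq> {}"
      using vertex_in_realization[OF vert] by blast
    from exact_seq_empty_subspace[OF this empty, of "\<lambda>_. 0"] show ?thesis
      unfolding True by (simp add: f_def d_def HK HL HL1)
  next
    case False
    \<comment> \<open>Away from degree 0 reduced and unreduced homology of \<open>K\<close> agree,
      and \<open>i - 1\<close> is not the exceptional degree of \<open>L\<close>.\<close>
    have "?H i K = homology_group i RK"
      unfolding HK by (rule un_reduced_homology_group[OF False])
    moreover have "exact_seq ([?H (i - 1) K, ?H (i - 1) L, ?H i K, ?H i K, ?H i L],
        [f (i - 1), \<lambda>_. \<one>\<^bsub>?H (i - 1) L\<^esub>, hom_induced i RK {} RK {} id, f i])"
    proof (rule exact_seq_trivial_sides[OF grp grp _ grp f f1 f])
      show "trivial_group (?H (i - 1) L)"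
        using False by (intro triv) simp
      show "hom_induced i RK {} RK {} id a = a" if "a \<in> carrier (?H i K)" for a
        using that hom_induced_id \<open>?H i K = homology_group i RK\<close> by metis
    qed
    ultimately show ?thesis
      using False by (simp add: d_def)
  qed
  then show ?thesis
    unfolding empty by (intro exI[of _ f] exI[of _ d]) (auto simp: f_def)
qed

theorem long_exact_sequence:
  assumes vert: "{x} \<in> K"
  shows "\<exists>f g d :: int \<Rightarrow> ('a \<Rightarrow> real) chain set \<Rightarrow> ('a \<Rightarrow> real) chain set.
    (\<forall>i\<ge>0. f i = hom_induced i RL {} RK {} id) \<and> (\<forall>i\<ge>0. g i = hom_induced i RK {} RM {} id) \<and>
    (\<forall>i. exact_seq ([complex_reduced_homology (i - 1) K, complex_reduced_homology (i - 1) L,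
        complex_reduced_homology i coned, complex_reduced_homology i K, complex_reduced_homology i L],
        [f (i - 1), d i, g i, f i]))"
proof -
  let ?H = "complex_reduced_homology"
  obtain f d where fd: "\<And>i. i \<ge> 0 \<Longrightarrow> f i = hom_induced i RL {} RK {} id"
    "\<And>i. exact_seq ([?H (i - 1) K, ?H (i - 1) L,
        relative_homology_group i RK (topspace RL), ?H i K, ?H i L],
        [f (i - 1), d i, hom_induced i RK {} RK (topspace RL) id, f i])"
    using exact_seq_relative[OF vert] by blast
  have HK: "?H i K = reduced_homology_group i RK" and HM: "?H i coned = reduced_homology_group i RM" for i
    using complex_reduced_homology_nonempty[of x] vert by blast+
  have "\<forall>i. \<exists>\<phi>. \<phi> \<in> iso (?H i coned) (relative_homology_group i RK (topspace RL)) \<and>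
      (\<forall>c \<in> carrier (?H i K). \<phi> (hom_induced i RK {} RM {} id c) = hom_induced i RK {} RK (topspace RL) id c)"
    unfolding HK HM using relative_homology_iso by (intro allI) (simp only: Bex_def)
  from choice[OF this] obtain \<phi> where "\<forall>i. \<phi> i \<in> iso (?H i coned) (relative_homology_group i RK (topspace RL)) \<and>
      (\<forall>c \<in> carrier (?H i K). \<phi> i (hom_induced i RK {} RM {} id c) = hom_induced i RK {} RK (topspace RL) id c)"
    by (elim exE)
  then have \<phi>: "\<phi> i \<in> iso (?H i coned) (relative_homology_group i RK (topspace RL))"
    "c \<in> carrier (?H i K) \<Longrightarrow> \<phi> i (hom_induced i RK {} RM {} id c) = hom_induced i RK {} RK (topspace RL) id c" for i c
    by (simp_all only: simp_thms)
  have grp: "group (?H i coned)" for i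
    unfolding HM by (rule group_reduced_homology_group)
  have hom: "hom_induced i RK {} RM {} id \<in> hom (?H i K) (?H i coned)" for i
    unfolding HK HM by (rule hom_induced_reduced_hom)
  have ex: "exact_seq ([?H (i - 1) K, ?H (i - 1) L, ?H i coned, ?H i K, ?H i L],
        [f (i - 1), d i \<circ> \<phi> i, hom_induced i RK {} RM {} id, f i])" for i
    by (rule exact_seq_replace_iso[OF fd(2) grp \<phi>(1) hom \<phi>(2)])
  show ?thesis
    by (rule exI[of _ f], rule exI[of _ "\<lambda>i. hom_induced i RK {} RM {} id"], rule exI[of _ "\<lambda>i. d i \<circ> \<phi> i"])
      (intro conjI allI impI fd(1) refl ex)
qed

end

text \<open>The void complex is treated apart in the wedge statement because
  \<open>suspension\<close> sees only the realization and gives two points for \<open>{}\<close> and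
  \<open>{{}}\<close> alike, whereas coning off the void complex does not even add the apex.\<close>

theorem theorem3p11:
  fixes G :: "'a graph" and v :: 'a and k :: nat
  assumes "finite_simple_graph G" and "v \<notin> fst G" and "k \<ge> 2"
  shows
    "(realization (total_cut_complex k (add_isolated_vertex G v)) homotopy_equivalent_space
        complex_quotient (total_cut_complex (k - 1) G) (total_cut_complex k G)) \<and>
     (contractible_in (realization (total_cut_complex k G))
        (realization (total_cut_complex (k - 1) G)) \<longrightarrow>
      (if total_cut_complex k G = {}
       then realization (total_cut_complex k (add_isolated_vertex G v)) homotopy_equivalent_space
              realization (total_cut_complex (k - 1) G)
       else \<forall>x \<in> topspace (realization (total_cut_complex (k - 1) G)).
            \<forall>y \<in> topspace (suspension (realization (total_cut_complex k G))).
              realization (total_cut_complex k (add_isolated_vertex G v)) homotopy_equivalent_space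
                wedge (realization (total_cut_complex (k - 1) G)) x
                  (suspension (realization (total_cut_complex k G))) y)) \<and>
     (\<exists>f g d :: int \<Rightarrow> ('a \<Rightarrow> real) chain set \<Rightarrow> ('a \<Rightarrow> real) chain set.
       (\<forall>i\<ge>0. f i = hom_induced i (realization (total_cut_complex k G)) {}
                      (realization (total_cut_complex (k - 1) G)) {} id) \<and>
       (\<forall>i\<ge>0. g i = hom_induced i (realization (total_cut_complex (k - 1) G)) {}
                      (realization (total_cut_complex k (add_isolated_vertex G v))) {} id) \<and>
       (\<forall>i. exact_seq
          ([complex_reduced_homology (i - 1) (total_cut_complex (k - 1) G),
            complex_reduced_homology (i - 1) (total_cut_complex k G),
            complex_reduced_homology i (total_cut_complex k (add_isolated_vertex G v)),
            complex_reduced_homology i (total_cut_complex (k - 1) G),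
            complex_reduced_homology i (total_cut_complex k G)],
           [f (i - 1), d i, g i, f i])))"
proof (cases "total_cut_complex k G = {}")
  case True
  let ?K = "total_cut_complex (k - 1) G"
  have M: "total_cut_complex k (add_isolated_vertex G v) = ?K"
    using total_cut_complex_add_isolated_vertex[OF assms(1,2), of k] assms(3) True by simp
  \<comment> \<open>With nothing collapsed, the quotient along the injective map \<open>Some\<close>
    is a copy of the space.\<close>
  have "homeomorphic_map (realization ?K) (quotient_topology (realization ?K) Some) Some"
    using quotient_map_quotient_topology[of "realization ?K" Some]
    by (simp add: homeomorphic_map_def)
  then have "realization ?K homotopy_equivalent_space complex_quotient ?K {}"
    unfolding complex_quotient_def
    by (simp add: homeomorphic_imp_homotopy_equivalent_space homeomorphic_map_imp_homeomorphic_space)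
  then show ?thesis
    using exact_seq_void_subcomplex[of ?K] unfolding True M by (simp add: homotopy_equivalent_space_refl)
next
  case False
  let ?K = "total_cut_complex (k - 1) G" and ?L = "total_cut_complex k G"
  have k: "k \<ge> 1"
    using assms(3) by simp
  interpret finite_complex "fst G" ?K
    by (rule finite_complex_total_cut_complex[OF assms(1)])
  interpret L0: finite_complex "fst G" ?L
    by (rule finite_complex_total_cut_complex[OF assms(1)])
  interpret coned_subcomplex "fst G" ?K ?L v
    using total_cut_complex_mono[OF k, of G] L0.face_subset False assms(2) by unfold_locales
  note M = total_cut_complex_add_isolated_vertex[OF assms(1,2) k]
  have "RM homotopy_equivalent_space complex_quotient ?K ?L"
    using homotopy_equivalent_quotient False by (simp add: complex_quotient_def)
  moreover have "RM homotopy_equivalent_space wedge RK x (suspension RL) y"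
    if c: "contractible_in RL RK" and x: "x \<in> topspace RK" and y: "y \<in> topspace (suspension RL)" for x y
  proof (rule homotopy_equivalent_wedge[OF _ x y])
    show "homotopic_with (\<lambda>_. True) RL RK id (\<lambda>_. x)"
    \<comment> \<open>Contractibility supplies some constant \<open>c\<close>, not the prescribed
      \<open>x\<close>; path connectedness of \<open>RK\<close> moves one to the other. On an empty
      \<open>RL\<close> any two maps agree.\<close>
    proof (cases "topspace RL = {}")
      case True
      then show ?thesis
        by (intro homotopic_with_equal) auto
    next
      case False
      then obtain l where l: "l \<in> topspace RL"
        by blast
      obtain w where w: "w \<in> support l"
        using support_nonempty[OF l] by blast
      then have "{w} \<in> ?L"
        using support_in_complex[OF l] L0.face_subset[of "support l" "{w}"] by auto
      then have "{x, w} \<in> ?K" if "{x} \<in> ?K" for x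
        using total_cut_complex_edge[OF k, of w G x] faces that by blast
      then have conn: "path_connected_space RK"
        by (rule path_connected_space_realization)
      obtain c where c: "homotopic_with (\<lambda>_. True) RL RK id (\<lambda>_. c)"
        using c unfolding contractible_in_def by blast
      then have "c \<in> topspace RK"
        using homotopic_with_imp_continuous_maps[OF c] l by (auto simp: continuous_map_def)
      then have "homotopic_with (\<lambda>_. True) RL RK (\<lambda>_. c) (\<lambda>_. x)"
        using conn x False by (simp add: homotopic_constant_maps path_connected_space_iff_path_component)
      with c show ?thesis
        by (rule homotopic_with_trans)
    qed
  qed
  moreover obtain x where "{x} \<in> ?K"
    using total_cut_complex_has_vertex[OF assms(1,3) False] by blast
  note long_exact_sequence[OF this]
  ultimately show ?thesis
    unfolding M using False by auto
qed

end
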